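(* For Kostant–Souriau quantization of coadjoint orbits, the two notions of coherent states (Rawnsley coherent states, and coherent states obtained by moving a "vacuum" vector by the group action) are the same.
   Context: Setting: $M$ is a coadjoint orbit of a group $G$ and $L\to M$ is the prequantum line bundle of its Kostant–Souriau quantization. The representation module is the space of sections of $L$ (polarized sections, for quantization), and the representation is the representation of $G$ induced from a character $\eta$ of the stabilizer $H$ of an element of the orbit, acting on the fiber of $L$ at that element. Explicitly, $M=G/H$ and $L=(G\times V)/\sim$, where $V$ is the one-dimensional fiber on which $H$ acts by $\eta$ and $(g,v)\sim(gh,\eta(h^{-1})v)$ for $h\in H$. $G$ acts on $L$ by $g'\cdot(g,v)=(g'g,v)$ and on sections by $(g\cdot\phi)(y)=g\cdot(\phi(g^{-1}y))$ for $y\in M$. The $G$-action on the Hilbert space of sections is unitary. Rawnsley coherent states: let $L_0$ be the principal $\mathbb{C}^*$-bundle of nonzero elements of $L$, with projection $\pi$ to $M$. For $q\in L_0$, the functional $\Delta_q$ on the pre-Hilbert space of smooth square-integrable sections is defined by $\Delta_q(s)\,q=s(\pi q)$. It is extended to a continuous linear functional $\tilde\Delta_q$ on the Hilbert space obtained by $L^2$-completion, and the Riesz representation theorem gives a vector $e_q$ with $\tilde\Delta_q(s)\,q=(e_q,s)\,q$, where $(\cdot,\cdot)$ is the inner product of the Hilbert space. For $q,q_1$ in the same fiber, $e_q$ and $e_{q_1}$ differ by multiplication by a constant. This gives a map from $M$ to the projectivization of the Hilbert space; the projectivized state to which $x\in M$ maps is the Rawnsley coherent state at $x$. Coherent states from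 the group action: given the unitary $G$-action on the Hilbert space of sections, these are the states of the form $g\psi_0$, $g\in G$, where $\psi_0$ is the "vacuum" state (the coherent states are described as obtained by moving any "vacuum" vector by the group action). How the two notions are compared: take a generic section $s$ of $L$, nonzero outside a set of measure zero, and a point $x$ with $s(x)\neq 0$, so that $(e_{s(x)},s_1)=s_1(x)/s(x)$ for any smooth section $s_1$ in the Hilbert space. The two notions agree when, for $g\in G$, $g\,e_{s(x)}=c\,e_{s(gx)}$ with $c$ a constant. By unitarity this means $c\,\frac{s_1(gx)}{s(gx)}=\frac{(g^{-1}s_1)(x)}{s(x)}$. *)

theory Defs
  imports "HOL-Analysis.Analysis" "HOL-Algebra.Group"
begin

section \<open>Lie groups\<close>

text \<open>In finite dimension, \<open>C\<^sup>k\<close> regularity on an open set via iterated directional derivatives.\<close>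

primrec Ck_on :: "nat \<Rightarrow> 'a::real_normed_vector set \<Rightarrow> ('a \<Rightarrow> 'b::real_normed_vector) \<Rightarrow> bool" where
  "Ck_on 0 S f \<longleftrightarrow> continuous_on S f"
| "Ck_on (Suc k) S f \<longleftrightarrow>
     (\<forall>x\<in>S. f differentiable (at x)) \<and> (\<forall>v. Ck_on k S (\<lambda>x. frechet_derivative f (at x) v))"

definition smooth_on :: "'a::real_normed_vector set \<Rightarrow> ('a \<Rightarrow> 'b::real_normed_vector) \<Rightarrow> bool" where
  "smooth_on S f \<longleftrightarrow> (\<forall>k. Ck_on k S f)"

text \<open>A chart is a pair of its domain and its coordinate map; the coordinate map is meaningful
  only on the domain. The topology of a manifold is the one induced by its charts.\<close>

type_synonym ('g, 'e) chart = "'g set \<times> ('g \<Rightarrow> 'e)"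

record ('g, 'e) lie_data = "'g monoid" +
  atlas :: "('g, 'e) chart set"

definition mtop :: "('g, 'e::euclidean_space, 'm) lie_data_scheme \<Rightarrow> 'g topology" where
  "mtop Q = topology (\<lambda>W. W \<subseteq> carrier Q \<and> (\<forall>(U, \<kappa>)\<in>atlas Q. open (\<kappa> ` (W \<inter> U))))"

definition smooth_manifold :: "('g, 'e::euclidean_space, 'm) lie_data_scheme \<Rightarrow> bool" where
  "smooth_manifold Q \<longleftrightarrow>
     (\<Union>(U, \<kappa>)\<in>atlas Q. U) = carrier Q \<and>
     (\<forall>(U, \<kappa>)\<in>atlas Q. inj_on \<kappa> U \<and> open (\<kappa> ` U)) \<and>
     (\<forall>(U, \<kappa>)\<in>atlas Q. \<forall>(U', \<kappa>')\<in>atlas Q.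
        open (\<kappa> ` (U \<inter> U')) \<and> smooth_on (\<kappa> ` (U \<inter> U')) (\<kappa>' \<circ> inv_into U \<kappa>)) \<and>
     Hausdorff_space (mtop Q) \<and> second_countable (mtop Q)"

definition lie_group :: "('g, 'e::euclidean_space, 'm) lie_data_scheme \<Rightarrow> bool" where
  "lie_group Q \<longleftrightarrow>
     group Q \<and> smooth_manifold Q \<and>
     (\<forall>(U1, \<kappa>1)\<in>atlas Q. \<forall>(U2, \<kappa>2)\<in>atlas Q. \<forall>(U3, \<kappa>3)\<in>atlas Q.
        let D = {(\<kappa>1 x, \<kappa>2 y) |x y. x \<in> U1 \<and> y \<in> U2 \<and> x \<otimes>\<^bsub>Q\<^esub> y \<in> U3}
        in open D \<and>
           smooth_on D (\<lambda>(a, b). \<kappa>3 (inv_into U1 \<kappa>1 a \<otimes>\<^bsub>Q\<^esub> inv_into U2 \<kappa>2 b))) \<and>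
     (\<forall>(U1, \<kappa>1)\<in>atlas Q. \<forall>(U2, \<kappa>2)\<in>atlas Q.
        let D = \<kappa>1 ` {x\<in>U1. inv\<^bsub>Q\<^esub> x \<in> U2}
        in open D \<and> smooth_on D (\<lambda>a. \<kappa>2 (inv\<^bsub>Q\<^esub> (inv_into U1 \<kappa>1 a))))"

definition smooth_fun ::
    "('g, 'e::euclidean_space, 'm) lie_data_scheme \<Rightarrow> ('g \<Rightarrow> complex) \<Rightarrow> bool" where
  "smooth_fun Q f \<longleftrightarrow> (\<forall>(U, \<kappa>)\<in>atlas Q. smooth_on (\<kappa> ` U) (f \<circ> inv_into U \<kappa>))"

definition borel_fun ::
    "('g, 'e::euclidean_space, 'm) lie_data_scheme \<Rightarrow> ('g \<Rightarrow> complex) \<Rightarrow> bool" where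
  "borel_fun Q f \<longleftrightarrow> f \<in> borel_measurable (sigma (carrier Q) {W. openin (mtop Q) W})"


section \<open>Lie algebra and coadjoint action\<close>

text \<open>The Lie algebra (tangent space at the identity) is identified with the model space by the
  differential of one fixed chart around the identity. Covectors are linear functionals on it.\<close>

definition chart1 :: "('g, 'e::euclidean_space, 'm) lie_data_scheme \<Rightarrow> ('g, 'e) chart" where
  "chart1 Q = (SOME c. c \<in> atlas Q \<and> \<one>\<^bsub>Q\<^esub> \<in> fst c)"

definition coord :: "('g, 'e::euclidean_space, 'm) lie_data_scheme \<Rightarrow> 'g \<Rightarrow> 'e" where
  "coord Q = snd (chart1 Q)"

definition uncoord :: "('g, 'e::euclidean_space, 'm) lie_data_scheme \<Rightarrow> 'e \<Rightarrow> 'g" where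
  "uncoord Q = inv_into (fst (chart1 Q)) (snd (chart1 Q))"

text \<open>The differential at the identity, in direction \<open>X\<close>, of a map defined on the group.\<close>

definition diff1 :: "('g, 'e::euclidean_space, 'm) lie_data_scheme \<Rightarrow>
    ('g \<Rightarrow> 'b::real_normed_vector) \<Rightarrow> 'e \<Rightarrow> 'b" where
  "diff1 Q f X = frechet_derivative (\<lambda>a. f (uncoord Q a)) (at (coord Q \<one>\<^bsub>Q\<^esub>)) X"

definition Ad :: "('g, 'e::euclidean_space, 'm) lie_data_scheme \<Rightarrow> 'g \<Rightarrow> 'e \<Rightarrow> 'e" where
  "Ad Q g = diff1 Q (\<lambda>x. coord Q (g \<otimes>\<^bsub>Q\<^esub> x \<otimes>\<^bsub>Q\<^esub> inv\<^bsub>Q\<^esub> g))"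

definition bracket :: "('g, 'e::euclidean_space, 'm) lie_data_scheme \<Rightarrow> 'e \<Rightarrow> 'e \<Rightarrow> 'e" where
  "bracket Q X Y = diff1 Q (\<lambda>x. Ad Q x Y) X"

definition coad ::
    "('g, 'e::euclidean_space, 'm) lie_data_scheme \<Rightarrow> 'g \<Rightarrow> ('e \<Rightarrow> real) \<Rightarrow> ('e \<Rightarrow> real)" where
  "coad Q g \<xi> = (\<lambda>X. \<xi> (Ad Q (inv\<^bsub>Q\<^esub> g) X))"

text \<open>The left-invariant vector field generated by \<open>X\<close>, applied to \<open>f\<close>, at the point \<open>g\<close>.\<close>

definition left_deriv :: "('g, 'e::euclidean_space, 'm) lie_data_scheme \<Rightarrow>
    'e \<Rightarrow> ('g \<Rightarrow> complex) \<Rightarrow> 'g \<Rightarrow> complex" where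
  "left_deriv Q X f g = diff1 Q (\<lambda>x. f (g \<otimes>\<^bsub>Q\<^esub> x)) X"

definition one_param ::
    "('g, 'e::euclidean_space, 'm) lie_data_scheme \<Rightarrow> (real \<Rightarrow> 'g) \<Rightarrow> 'e \<Rightarrow> bool" where
  "one_param Q \<gamma> X \<longleftrightarrow>
     continuous_map euclidean (mtop Q) \<gamma> \<and> (\<forall>t u. \<gamma> (t + u) = \<gamma> t \<otimes>\<^bsub>Q\<^esub> \<gamma> u) \<and>
     ((\<lambda>t. coord Q (\<gamma> t)) has_vector_derivative X) (at 0)"


section \<open>Coadjoint orbit, prequantum line bundle, invariant measure\<close>

record ('g, 'e) quantum_data = "('g, 'e) lie_data" +
  covec :: "'e \<Rightarrow> real"                \<comment> \<open>base point of the orbit\<close>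
  hbar :: real
  chr :: "'g \<Rightarrow> complex"               \<comment> \<open>the character \<open>\<eta>\<close>; meaningful on the stabilizer only\<close>
  vol :: "('e \<Rightarrow> real) measure"

definition orbit :: "('g, 'e::euclidean_space, 'm) quantum_data_scheme \<Rightarrow> ('e \<Rightarrow> real) set" where
  "orbit Q = {coad Q g (covec Q) |g. g \<in> carrier Q}"

definition stab :: "('g, 'e::euclidean_space, 'm) quantum_data_scheme \<Rightarrow> 'g set" where
  "stab Q = {h\<in>carrier Q. coad Q h (covec Q) = covec Q}"

definition stab_alg :: "('g, 'e::euclidean_space, 'm) quantum_data_scheme \<Rightarrow> 'e set" where
  "stab_alg Q = {X. \<exists>\<gamma>. one_param Q \<gamma> X \<and> range \<gamma> \<subseteq> stab Q}"

text \<open>Kostant's integrality condition: \<open>\<eta>\<close> is a continuous unitary character of the stabilizer whose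
  differential is \<open>(\<i>/\<hbar>)\<close> times the base covector \<open>F\<close>. It makes the invariant connection
  \<open>\<nabla>\<^sub>X = X + (\<i>/\<hbar>) F(X)\<close> (on equivariant functions, \<open>X\<close> left-invariant) descend to the line
  bundle, with curvature a multiple of the Kirillov--Kostant--Souriau form.\<close>

definition prequantum_character :: "('g, 'e::euclidean_space, 'm) quantum_data_scheme \<Rightarrow> bool" where
  "prequantum_character Q \<longleftrightarrow>
     (\<forall>h\<in>stab Q. \<forall>k\<in>stab Q. chr Q (h \<otimes>\<^bsub>Q\<^esub> k) = chr Q h * chr Q k) \<and>
     (\<forall>h\<in>stab Q. cmod (chr Q h) = 1) \<and>
     continuous_map (subtopology (mtop Q) (stab Q)) euclidean (chr Q) \<and>
     (\<forall>\<gamma> X. one_param Q \<gamma> X \<and> range \<gamma> \<subseteq> stab Q \<longrightarrow>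
        (\<forall>t. chr Q (\<gamma> t) = exp (\<i> * complex_of_real (t * covec Q X / hbar Q))))"

text \<open>The orbit carries the topology and the Borel structure of \<open>G/H\<close>, which may differ from those
  induced by the dual of the Lie algebra when the orbit is not locally closed.\<close>

definition orbit_top ::
    "('g, 'e::euclidean_space, 'm) quantum_data_scheme \<Rightarrow> ('e \<Rightarrow> real) topology" where
  "orbit_top Q = topology (\<lambda>W. W \<subseteq> orbit Q \<and>
     openin (mtop Q) {g\<in>carrier Q. coad Q g (covec Q) \<in> W})"

definition orbit_borel ::
    "('g, 'e::euclidean_space, 'm) quantum_data_scheme \<Rightarrow> ('e \<Rightarrow> real) set set" where
  "orbit_borel Q = {B. B \<subseteq> orbit Q \<and>
     {g\<in>carrier Q. coad Q g (covec Q) \<in> B} \<in> sigma_sets (carrier Q) {W. openin (mtop Q) W}}"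

text \<open>A nonzero, locally finite, \<open>G\<close>-invariant Borel measure on the orbit. It is the Liouville measure
  up to a positive factor, because such a measure on \<open>G/H\<close> is unique up to scaling.\<close>

definition invariant_volume :: "('g, 'e::euclidean_space, 'm) quantum_data_scheme \<Rightarrow> bool" where
  "invariant_volume Q \<longleftrightarrow>
     space (vol Q) = orbit Q \<and> sets (vol Q) = orbit_borel Q \<and>
     emeasure (vol Q) (orbit Q) \<noteq> 0 \<and>
     (\<forall>K. compactin (orbit_top Q) K \<and> K \<in> sets (vol Q) \<longrightarrow> emeasure (vol Q) K < \<infinity>) \<and>
     (\<forall>g\<in>carrier Q. \<forall>B\<in>sets (vol Q). emeasure (vol Q) (coad Q g ` B) = emeasure (vol Q) B)"

definition kostant_souriau_data :: "('g, 'e::euclidean_space, 'm) quantum_data_scheme \<Rightarrow> bool" where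
  "kostant_souriau_data Q \<longleftrightarrow>
     lie_group Q \<and> linear (covec Q) \<and> hbar Q > 0 \<and> prequantum_character Q \<and> invariant_volume Q"

text \<open>The line bundle \<open>L = (G \<times> \<complex>)/\<sim>\<close> with \<open>(g, v) \<sim> (g h, \<eta>(h\<^sup>-\<^sup>1) v)\<close>; its points are
  equivalence classes, i.e. sets of pairs.\<close>

type_synonym 'g line_pt = "('g \<times> complex) set"

definition lcls :: "('g, 'e::euclidean_space, 'm) quantum_data_scheme \<Rightarrow> 'g \<Rightarrow> complex \<Rightarrow> 'g line_pt" where
  "lcls Q g v = {(g \<otimes>\<^bsub>Q\<^esub> h, chr Q (inv\<^bsub>Q\<^esub> h) * v) |h. h \<in> stab Q}"

definition lbundle :: "('g, 'e::euclidean_space, 'm) quantum_data_scheme \<Rightarrow> 'g line_pt set" where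
  "lbundle Q = {lcls Q g v |g v. g \<in> carrier Q}"

definition lbundle0 :: "('g, 'e::euclidean_space, 'm) quantum_data_scheme \<Rightarrow> 'g line_pt set" where
  "lbundle0 Q = {lcls Q g v |g v. g \<in> carrier Q \<and> v \<noteq> 0}"

definition lproj :: "('g, 'e::euclidean_space, 'm) quantum_data_scheme \<Rightarrow> 'g line_pt \<Rightarrow> ('e \<Rightarrow> real)" where
  "lproj Q q = (THE x. \<exists>g v. (g, v) \<in> q \<and> x = coad Q g (covec Q))"

definition lact :: "('g, 'e::euclidean_space, 'm) quantum_data_scheme \<Rightarrow> 'g \<Rightarrow> 'g line_pt \<Rightarrow> 'g line_pt" where
  "lact Q g q = (\<lambda>(a, v). (g \<otimes>\<^bsub>Q\<^esub> a, v)) ` q"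

definition lscale :: "complex \<Rightarrow> 'g line_pt \<Rightarrow> 'g line_pt" where
  "lscale z q = (\<lambda>(a, v). (a, z * v)) ` q"

definition ladd :: "'g line_pt \<Rightarrow> 'g line_pt \<Rightarrow> 'g line_pt" where
  "ladd q r = {(a, v + w) |a v w. (a, v) \<in> q \<and> (a, w) \<in> r}"

text \<open>Hermitian metric on the fibres, antilinear in the first argument; independent of the
  representatives because \<open>\<eta>\<close> is unitary.\<close>

definition lherm :: "'g line_pt \<Rightarrow> 'g line_pt \<Rightarrow> complex" where
  "lherm q r = (THE z. \<exists>a v w. (a, v) \<in> q \<and> (a, w) \<in> r \<and> z = cnj v * w)"


section \<open>Sections\<close>

type_synonym ('g, 'e) sec = "('e \<Rightarrow> real) \<Rightarrow> 'g line_pt"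

definition lsections :: "('g, 'e::euclidean_space, 'm) quantum_data_scheme \<Rightarrow> ('g, 'e) sec set" where
  "lsections Q = (\<Pi>\<^sub>E x\<in>orbit Q. {q\<in>lbundle Q. lproj Q q = x})"

definition sact :: "('g, 'e::euclidean_space, 'm) quantum_data_scheme \<Rightarrow>
    'g \<Rightarrow> ('g, 'e) sec \<Rightarrow> ('g, 'e) sec" where
  "sact Q g s = (\<lambda>y\<in>orbit Q. lact Q g (s (coad Q (inv\<^bsub>Q\<^esub> g) y)))"

definition sscale :: "('g, 'e::euclidean_space, 'm) quantum_data_scheme \<Rightarrow>
    complex \<Rightarrow> ('g, 'e) sec \<Rightarrow> ('g, 'e) sec" where
  "sscale Q z s = (\<lambda>y\<in>orbit Q. lscale z (s y))"

definition sdiff :: "('g, 'e::euclidean_space, 'm) quantum_data_scheme \<Rightarrow>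
    ('g, 'e) sec \<Rightarrow> ('g, 'e) sec \<Rightarrow> ('g, 'e) sec" where
  "sdiff Q s s' = (\<lambda>y\<in>orbit Q. ladd (s y) (lscale (- 1) (s' y)))"

text \<open>The function \<open>f\<close> on \<open>G\<close>, with \<open>f(g h) = \<eta>(h)\<^sup>-\<^sup>1 f(g)\<close>, that represents a section:
  \<open>s(g F) = [g, f(g)]\<close>. Smoothness and measurability of a section are those of \<open>f\<close>.\<close>

definition lift :: "('g, 'e::euclidean_space, 'm) quantum_data_scheme \<Rightarrow>
    ('g, 'e) sec \<Rightarrow> 'g \<Rightarrow> complex" where
  "lift Q s g = (THE v. (g, v) \<in> s (coad Q g (covec Q)))"

definition sinner :: "('g, 'e::euclidean_space, 'm) quantum_data_scheme \<Rightarrow>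
    ('g, 'e) sec \<Rightarrow> ('g, 'e) sec \<Rightarrow> complex" where
  "sinner Q s s' = (\<integral>x. lherm (s x) (s' x) \<partial>vol Q)"

definition snorm :: "('g, 'e::euclidean_space, 'm) quantum_data_scheme \<Rightarrow> ('g, 'e) sec \<Rightarrow> real" where
  "snorm Q s = sqrt (Re (sinner Q s s))"

definition L2_sections :: "('g, 'e::euclidean_space, 'm) quantum_data_scheme \<Rightarrow> ('g, 'e) sec set" where
  "L2_sections Q = {s\<in>lsections Q. borel_fun Q (lift Q s) \<and> integrable (vol Q) (\<lambda>x. lherm (s x) (s x))}"

definition smooth_L2_sections ::
    "('g, 'e::euclidean_space, 'm) quantum_data_scheme \<Rightarrow> ('g, 'e) sec set" where
  "smooth_L2_sections Q = {s\<in>L2_sections Q. smooth_fun Q (lift Q s)}"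

text \<open>A \<open>G\<close>-invariant polarization of the orbit, given by its fibre at the base point, pulled back to
  the complexified Lie algebra; the pair \<open>(X, Y)\<close> stands for \<open>X + \<i>Y\<close>. The conditions say: complex
  subspace containing the stabilizer algebra, invariant under the stabilizer, involutive, isotropic
  for \<open>F([\<cdot>,\<cdot>])\<close>, and of Lagrangian dimension (\<open>dim\<close> is the real dimension, so this reads
  \<open>2 dim\<^sub>\<complex> p = dim G + dim H\<close>).\<close>

definition cbracket :: "('g, 'e::euclidean_space, 'm) lie_data_scheme \<Rightarrow> 'e \<times> 'e \<Rightarrow> 'e \<times> 'e \<Rightarrow> 'e \<times> 'e" where
  "cbracket Q Z W =
     (bracket Q (fst Z) (fst W) - bracket Q (snd Z) (snd W),
      bracket Q (fst Z) (snd W) + bracket Q (snd Z) (fst W))"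

definition polarization ::
    "('g, 'e::euclidean_space, 'm) quantum_data_scheme \<Rightarrow> ('e \<times> 'e) set \<Rightarrow> bool" where
  "polarization Q p \<longleftrightarrow>
     subspace p \<and> (\<forall>(X, Y)\<in>p. (- Y, X) \<in> p) \<and>
     stab_alg Q \<times> stab_alg Q \<subseteq> p \<and>
     (\<forall>h\<in>stab Q. \<forall>(X, Y)\<in>p. (Ad Q h X, Ad Q h Y) \<in> p) \<and>
     (\<forall>Z\<in>p. \<forall>W\<in>p. cbracket Q Z W \<in> p) \<and>
     (\<forall>Z\<in>p. \<forall>W\<in>p. covec Q (fst (cbracket Q Z W)) = 0 \<and> covec Q (snd (cbracket Q Z W)) = 0) \<and>
     dim p = DIM('e) + dim (stab_alg Q)"

definition polarized :: "('g, 'e::euclidean_space, 'm) quantum_data_scheme \<Rightarrow>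
    ('e \<times> 'e) set \<Rightarrow> ('g, 'e) sec \<Rightarrow> bool" where
  "polarized Q p s \<longleftrightarrow> (\<forall>(X, Y)\<in>p. \<forall>g\<in>carrier Q.
     left_deriv Q X (lift Q s) g + \<i> * left_deriv Q Y (lift Q s) g
       + \<i> / complex_of_real (hbar Q) * (complex_of_real (covec Q X) + \<i> * complex_of_real (covec Q Y))
         * lift Q s g = 0)"

text \<open>The pre-Hilbert space: all smooth square-integrable sections, or the polarized ones.\<close>

definition prehilbert_module ::
    "('g, 'e::euclidean_space, 'm) quantum_data_scheme \<Rightarrow> ('g, 'e) sec set \<Rightarrow> bool" where
  "prehilbert_module Q \<Gamma> \<longleftrightarrow>
     \<Gamma> = smooth_L2_sections Q \<or>
     (\<exists>p. polarization Q p \<and> \<Gamma> = {s\<in>smooth_L2_sections Q. polarized Q p s})"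


section \<open>Hilbert space and its projectivization\<close>

text \<open>The \<open>L\<^sup>2\<close>-completion of \<open>\<Gamma>\<close>, realized as its closure among square-integrable sections.
  Its elements are sections rather than classes modulo null sets, so vectors are compared by
  \<open>sec_eq\<close>.\<close>

definition L2_conv :: "('g, 'e::euclidean_space, 'm) quantum_data_scheme \<Rightarrow>
    (nat \<Rightarrow> ('g, 'e) sec) \<Rightarrow> ('g, 'e) sec \<Rightarrow> bool" where
  "L2_conv Q \<sigma> \<psi> \<longleftrightarrow> (\<lambda>n. snorm Q (sdiff Q (\<sigma> n) \<psi>)) \<longlonglongrightarrow> 0"

definition hilb :: "('g, 'e::euclidean_space, 'm) quantum_data_scheme \<Rightarrow>
    ('g, 'e) sec set \<Rightarrow> ('g, 'e) sec set" where
  "hilb Q \<Gamma> = {\<psi>\<in>L2_sections Q. \<exists>\<sigma>. range \<sigma> \<subseteq> \<Gamma> \<and> L2_conv Q \<sigma> \<psi>}"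

definition sec_eq :: "('g, 'e::euclidean_space, 'm) quantum_data_scheme \<Rightarrow>
    ('g, 'e) sec \<Rightarrow> ('g, 'e) sec \<Rightarrow> bool" where
  "sec_eq Q \<phi> \<psi> \<longleftrightarrow> (AE x in vol Q. \<phi> x = \<psi> x)"

definition ray :: "('g, 'e::euclidean_space, 'm) quantum_data_scheme \<Rightarrow>
    ('g, 'e) sec set \<Rightarrow> ('g, 'e) sec \<Rightarrow> ('g, 'e) sec set" where
  "ray Q \<Gamma> \<psi> = {\<phi>\<in>hilb Q \<Gamma>. \<exists>c. c \<noteq> 0 \<and> sec_eq Q \<phi> (sscale Q c \<psi>)}"

definition proj_hilb :: "('g, 'e::euclidean_space, 'm) quantum_data_scheme \<Rightarrow>
    ('g, 'e) sec set \<Rightarrow> ('g, 'e) sec set set" where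
  "proj_hilb Q \<Gamma> = {ray Q \<Gamma> \<psi> |\<psi>. \<psi> \<in> hilb Q \<Gamma> \<and> snorm Q \<psi> \<noteq> 0}"


section \<open>Coherent states\<close>

text \<open>\<open>\<Delta>\<^sub>q(s) q = s(\<pi> q)\<close> for \<open>q\<close> in the bundle of nonzero elements.\<close>

definition ev :: "('g, 'e::euclidean_space, 'm) quantum_data_scheme \<Rightarrow>
    'g line_pt \<Rightarrow> ('g, 'e) sec \<Rightarrow> complex" where
  "ev Q q s = (THE z. lscale z q = s (lproj Q q))"

definition ev_bounded :: "('g, 'e::euclidean_space, 'm) quantum_data_scheme \<Rightarrow>
    ('g, 'e) sec set \<Rightarrow> 'g line_pt \<Rightarrow> bool" where
  "ev_bounded Q \<Gamma> q \<longleftrightarrow> (\<exists>B. \<forall>s\<in>\<Gamma>. cmod (ev Q q s) \<le> B * snorm Q s)"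

text \<open>Extension by continuity of \<open>\<Delta>\<^sub>q\<close> to the Hilbert space.\<close>

definition ev_ext :: "('g, 'e::euclidean_space, 'm) quantum_data_scheme \<Rightarrow>
    ('g, 'e) sec set \<Rightarrow> 'g line_pt \<Rightarrow> ('g, 'e) sec \<Rightarrow> complex" where
  "ev_ext Q \<Gamma> q \<psi> =
     (THE z. \<forall>\<sigma>. range \<sigma> \<subseteq> \<Gamma> \<and> L2_conv Q \<sigma> \<psi> \<longrightarrow> (\<lambda>n. ev Q q (\<sigma> n)) \<longlonglongrightarrow> z)"

definition coherent_vec :: "('g, 'e::euclidean_space, 'm) quantum_data_scheme \<Rightarrow>
    ('g, 'e) sec set \<Rightarrow> 'g line_pt \<Rightarrow> ('g, 'e) sec" where
  "coherent_vec Q \<Gamma> q =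
     (SOME e. e \<in> hilb Q \<Gamma> \<and> (\<forall>\<psi>\<in>hilb Q \<Gamma>. ev_ext Q \<Gamma> q \<psi> = sinner Q e \<psi>))"

definition rawnsley_state :: "('g, 'e::euclidean_space, 'm) quantum_data_scheme \<Rightarrow>
    ('g, 'e) sec set \<Rightarrow> ('e \<Rightarrow> real) \<Rightarrow> ('g, 'e) sec set" where
  "rawnsley_state Q \<Gamma> x =
     (THE r. \<exists>q\<in>lbundle0 Q. lproj Q q = x \<and> r = ray Q \<Gamma> (coherent_vec Q \<Gamma> q))"

definition group_coherent_states :: "('g, 'e::euclidean_space, 'm) quantum_data_scheme \<Rightarrow>
    ('g, 'e) sec set \<Rightarrow> ('g, 'e) sec \<Rightarrow> ('g, 'e) sec set set" where
  "group_coherent_states Q \<Gamma> \<psi>0 = {ray Q \<Gamma> (sact Q g \<psi>0) |g. g \<in> carrier Q}"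

end

theory Submission
  imports Defs
begin

text \<open>
  The coherent vector \<open>e\<^sub>q\<close> is the vector that represents evaluation of sections at \<open>q\<close>:
  \<open>(e\<^sub>q, s) q = s(\<pi> q)\<close>. The group acts on the sections, the bundle and the orbit compatibly, and it acts
  unitarily because the volume is invariant. Hence \<open>(g e\<^sub>q, s) = (e\<^sub>q, g\<^sup>-\<^sup>1 s)\<close> is the value of \<open>s\<close> at \<open>g \<pi>(q)\<close>
  in units of \<open>g q\<close>, so \<open>g e\<^sub>q\<close> represents evaluation at \<open>g q\<close>, and uniqueness of the representing vector
  gives \<open>g e\<^sub>q = e\<^bsub>g q\<^esub>\<close> up to a null set (\<open>represents_sact\<close>, \<open>represents_unique\<close>). Replacing \<open>q\<close> by a
  multiple in its fibre only rescales \<open>e\<^sub>q\<close>, so the rays of coherent vectors are permuted by \<open>G\<close> exactly as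
  the points of the orbit are. The orbit is homogeneous, so the orbit of any one of these rays consists of
  all of them; this is the coincidence of the two notions. The same homogeneity shows that no coherent vector
  vanishes: sections that all vanish at one point would, by invariance of the module, vanish everywhere.

  Three ingredients need work. The first is analytic: coherent vectors must exist. The evaluation functional is
  bounded on the module \<open>\<Gamma>\<close> only, and the Hilbert space is its closure among honest sections, not
  equivalence classes. The representing vector is obtained by minimizing
  \<open>norm_sq s - 2 Re (\<Delta>\<^sub>q s)\<close> over \<open>\<Gamma>\<close> (\<open>Riesz_representation\<close>), and the minimizing sequence converges by
  the completeness of \<open>L\<^sup>2\<close> (\<open>fast_Cauchy_complete\<close>). Both are proved for functions on the orbit: choosing a
  representative of each coset identifies sections with functions.

  The second is differential: the module must be invariant under the action. On the functions on \<open>G\<close> that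
  represent sections the action is left translation, which is smooth in charts by the chain rule
  (\<open>Ck_on_compose\<close>) and commutes with the left-invariant derivatives in the polarization condition.

  The third is that the coadjoint map is an action at all: \<open>Ad\<close> is defined as a derivative, and
  \<open>Ad (g h) = Ad g \<circ> Ad h\<close> is the chain rule for conjugations (\<open>Ad_mult\<close>).
\<close>

section \<open>Maps of class \<open>C\<^sup>k\<close>\<close>

text \<open>The derivative at a point sees only a neighbourhood, so on an open set the values of a map outside
  the set are irrelevant. This is what makes the coordinate expressions below usable, since they are
  arbitrary outside the image of their chart.\<close>

lemma Ck_on_cong:
  assumes "open S" "\<And>x. x \<in> S \<Longrightarrow> f x = g x"
  shows "Ck_on k S f \<longleftrightarrow> Ck_on k S g"
  using assms(2)
proof (induction k arbitrary: f g)
  case 0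
  then show ?case by (simp cong: continuous_on_cong)
next
  case (Suc k)
  have hd: "(f has_derivative D) (at x) \<longleftrightarrow> (g has_derivative D) (at x)" if "x \<in> S" for x D
    by (metis that \<open>open S\<close> Suc.prems has_derivative_transform_within_open)
  have fd: "frechet_derivative f (at x) = frechet_derivative g (at x)" if "x \<in> S" for x
    unfolding frechet_derivative_def hd[OF that] ..
  have "Ck_on k S (\<lambda>x. frechet_derivative f (at x) v) \<longleftrightarrow>
        Ck_on k S (\<lambda>x. frechet_derivative g (at x) v)" for v
    by (rule Suc.IH) (simp add: fd)
  then show ?case by (simp add: differentiable_def hd)
qed

lemma Ck_on_local:
  assumes "\<And>x. x \<in> S \<Longrightarrow> \<exists>T. open T \<and> x \<in> T \<and> Ck_on k T f"
  shows "Ck_on k S f"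
  using assms
proof (induction k arbitrary: f)
  case 0
  show ?case unfolding Ck_on.simps
  proof (rule continuous_at_imp_continuous_on, intro ballI)
    fix x assume "x \<in> S"
    with 0 obtain T where "open T" "x \<in> T" "continuous_on T f" by auto
    then show "isCont f x" by (simp add: continuous_on_eq_continuous_at)
  qed
next
  case (Suc k)
  have "f differentiable at x" if "x \<in> S" for x
    using Suc.prems[OF that] by auto
  moreover have "Ck_on k S (\<lambda>x. frechet_derivative f (at x) v)" for v
  proof (rule Suc.IH)
    fix x assume "x \<in> S"
    then show "\<exists>T. open T \<and> x \<in> T \<and> Ck_on k T (\<lambda>x. frechet_derivative f (at x) v)"
      using Suc.prems by fastforce
  qed
  ultimately show ?case by simp
qed

lemma Ck_on_Suc_imp: "Ck_on (Suc k) S f \<Longrightarrow> Ck_on k S f"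
proof (induction k arbitrary: f)
  case 0
  then show ?case
    by (auto intro!: continuous_at_imp_continuous_on differentiable_imp_continuous_within)
next
  case (Suc k)
  then show ?case by auto
qed

lemma Ck_on_const: "Ck_on k S (\<lambda>x. c)"
  by (induction k arbitrary: c) (auto simp: frechet_derivative_const)

text \<open>The induction step used for sums, products and compositions: a formula for the derivative on \<open>S\<close>
  may replace \<^const>\<open>frechet_derivative\<close>.\<close>

lemma Ck_on_SucI:
  assumes "open S" "\<And>x. x \<in> S \<Longrightarrow> (f has_derivative D x) (at x)"
    and "\<And>v. Ck_on k S (\<lambda>x. D x v)"
  shows "Ck_on (Suc k) S f"
proof -
  have "frechet_derivative f (at x) = D x" if "x \<in> S" for x
    using frechet_derivative_at[OF assms(2)[OF that]] by simp
  then have "Ck_on k S (\<lambda>x. frechet_derivative f (at x) v)" for v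
    using assms(3)[of v] by (subst Ck_on_cong[OF \<open>open S\<close>, where g = "\<lambda>x. D x v"]) auto
  then show ?thesis
    using assms(2) by (auto simp: differentiable_def)
qed

lemma Ck_on_SucD:
  assumes "Ck_on (Suc k) S f" "x \<in> S"
  shows "(f has_derivative frechet_derivative f (at x)) (at x)"
  using assms by (auto simp: frechet_derivative_works)

lemma Ck_on_add:
  assumes "open S" "Ck_on k S f" "Ck_on k S g"
  shows "Ck_on k S (\<lambda>x. f x + g x)"
  using assms(2,3)
proof (induction k arbitrary: f g)
  case 0
  then show ?case by (auto intro: continuous_intros)
next
  case (Suc k)
  show ?case
  proof (rule Ck_on_SucI[OF \<open>open S\<close>])
    show "((\<lambda>x. f x + g x) has_derivative
        (\<lambda>v. frechet_derivative f (at x) v + frechet_derivative g (at x) v)) (at x)" if "x \<in> S" for x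
      using Suc.prems that by (intro has_derivative_add Ck_on_SucD)
    show "Ck_on k S (\<lambda>x. frechet_derivative f (at x) v + frechet_derivative g (at x) v)" for v
      using Suc.prems by (intro Suc.IH) auto
  qed
qed

lemma Ck_on_sum:
  assumes "open S" "\<And>i. i \<in> I \<Longrightarrow> Ck_on k S (f i)"
  shows "Ck_on k S (\<lambda>x. \<Sum>i\<in>I. f i x)"
  using assms(2) by (induction I rule: infinite_finite_induct)
    (auto intro: Ck_on_const Ck_on_add[OF \<open>open S\<close>])

lemma Ck_on_bilinear:
  assumes "bounded_bilinear B" "open S" "Ck_on k S f" "Ck_on k S g"
  shows "Ck_on k S (\<lambda>x. B (f x) (g x))"
  using assms(3,4)
proof (induction k arbitrary: f g)
  case 0
  then show ?case by (auto intro: bounded_bilinear.continuous_on[OF assms(1)])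
next
  case (Suc k)
  show ?case
  proof (rule Ck_on_SucI[OF \<open>open S\<close>])
    show "((\<lambda>x. B (f x) (g x)) has_derivative
        (\<lambda>v. B (f x) (frechet_derivative g (at x) v) + B (frechet_derivative f (at x) v) (g x))) (at x)"
      if "x \<in> S" for x
      using Suc.prems that by (intro bounded_bilinear.FDERIV[OF assms(1)] Ck_on_SucD)
    show "Ck_on k S (\<lambda>x. B (f x) (frechet_derivative g (at x) v) + B (frechet_derivative f (at x) v) (g x))" for v
      using Suc.prems Suc.prems[THEN Ck_on_Suc_imp]
      by (intro Ck_on_add[OF \<open>open S\<close>] Suc.IH) auto
  qed
qed

text \<open>The chain rule gives the derivative as \<open>Df(\<phi> x)(D\<phi>(x) v)\<close>, in which the direction varies with \<open>x\<close>, so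
  the induction hypothesis does not apply to it. Expanding the direction in the basis turns it into
  \<open>\<Sum>\<^sub>b (D\<phi>(x) v \<bullet> b) \<partial>\<^sub>bf(\<phi> x)\<close>, a sum of products of maps of class \<open>C\<^sup>k\<close>.\<close>

lemma Ck_on_compose:
  fixes f :: "'d::euclidean_space \<Rightarrow> 'b::real_normed_vector"
  assumes "open S" "open T" "Ck_on k T f" "Ck_on k S \<phi>" "\<phi> ` S \<subseteq> T"
  shows "Ck_on k S (\<lambda>x. f (\<phi> x))"
  using assms(3,4)
proof (induction k arbitrary: f)
  case 0
  then show ?case using assms(5) by (auto intro: continuous_on_compose2)
next
  case (Suc k)
  show ?case
  proof (rule Ck_on_SucI[OF \<open>open S\<close>])
    fix x assume x: "x \<in> S"
    have f: "(f has_derivative frechet_derivative f (at (\<phi> x))) (at (\<phi> x))"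
      using Suc.prems(1) x assms(5) by (intro Ck_on_SucD) auto
    have comp: "((\<lambda>x. f (\<phi> x)) has_derivative
        (\<lambda>v. frechet_derivative f (at (\<phi> x)) (frechet_derivative \<phi> (at x) v))) (at x)"
      by (rule has_derivative_compose[OF Ck_on_SucD[OF Suc.prems(2) x] f])
    have expand: "frechet_derivative f (at (\<phi> x)) w =
        (\<Sum>b\<in>Basis. (w \<bullet> b) *\<^sub>R frechet_derivative f (at (\<phi> x)) b)" for w
    proof -
      interpret linear "frechet_derivative f (at (\<phi> x))"
        by (rule has_derivative_linear[OF f])
      show ?thesis
        using sum[of "\<lambda>b. (w \<bullet> b) *\<^sub>R b" Basis]
        by (simp only: scale euclidean_representation)
    qed
    show "((\<lambda>x. f (\<phi> x)) has_derivative
        (\<lambda>v. \<Sum>b\<in>Basis. (frechet_derivative \<phi> (at x) v \<bullet> b) *\<^sub>R frechet_derivative f (at (\<phi> x)) b)) (at x)"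
      by (rule has_derivative_eq_rhs[OF comp]) (rule ext, rule expand)
  next
    fix v
    show "Ck_on k S (\<lambda>x. \<Sum>b\<in>Basis. (frechet_derivative \<phi> (at x) v \<bullet> b) *\<^sub>R frechet_derivative f (at (\<phi> x)) b)"
      using Suc.prems Suc.prems(2)[THEN Ck_on_Suc_imp]
      by (intro Ck_on_sum[OF \<open>open S\<close>] Ck_on_bilinear[OF bounded_bilinear_scaleR \<open>open S\<close>]
          Ck_on_bilinear[OF bounded_bilinear_inner \<open>open S\<close>] Ck_on_const Suc.IH) auto
  qed
qed

lemma Ck_on_affine:
  assumes "bounded_linear L" "open S"
  shows "Ck_on k S (\<lambda>x. c + L x)"
proof (cases k)
  case 0
  then show ?thesis
    using linear_continuous_on[OF assms(1)] by (auto intro!: continuous_intros)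
next
  case (Suc j)
  have "Ck_on (Suc j) S (\<lambda>x. c + L x)"
    by (rule Ck_on_SucI[OF \<open>open S\<close>, where D = "\<lambda>_. L"])
      (auto intro!: derivative_eq_intros bounded_linear_imp_has_derivative assms Ck_on_const)
  then show ?thesis using Suc by simp
qed

section \<open>Translations in a Lie group\<close>

locale lie_group_context =
  fixes Q :: "('g, 'e::euclidean_space, 'm) lie_data_scheme" (structure)
  assumes lie_group: "lie_group Q"
begin

sublocale group Q
  using lie_group by (simp add: lie_group_def)

lemma atlas_cover: "(\<Union>(U, \<kappa>)\<in>atlas Q. U) = carrier Q"
  using lie_group by (simp add: lie_group_def smooth_manifold_def)

lemma chart_at:
  assumes "x \<in> carrier Q"
  obtains U \<kappa> where "(U, \<kappa>) \<in> atlas Q" "x \<in> U"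
  using assms unfolding atlas_cover[symmetric] by auto

lemma chart_subset: "(U, \<kappa>) \<in> atlas Q \<Longrightarrow> U \<subseteq> carrier Q"
  unfolding atlas_cover[symmetric] by auto

lemma chart_inj: "(U, \<kappa>) \<in> atlas Q \<Longrightarrow> inj_on \<kappa> U"
  and chart_image_open: "(U, \<kappa>) \<in> atlas Q \<Longrightarrow> open (\<kappa> ` U)"
  using lie_group unfolding lie_group_def smooth_manifold_def by fast+

lemma chart_overlap_open:
  "(U, \<kappa>) \<in> atlas Q \<Longrightarrow> (U', \<kappa>') \<in> atlas Q \<Longrightarrow> open (\<kappa> ` (U \<inter> U'))"
  using lie_group unfolding lie_group_def smooth_manifold_def by fast

lemma mult_smooth_in_charts:
  assumes "(U1, \<kappa>1) \<in> atlas Q" "(U2, \<kappa>2) \<in> atlas Q" "(U3, \<kappa>3) \<in> atlas Q"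
  shows "open {(\<kappa>1 x, \<kappa>2 y) |x y. x \<in> U1 \<and> y \<in> U2 \<and> x \<otimes> y \<in> U3}"
    and "smooth_on {(\<kappa>1 x, \<kappa>2 y) |x y. x \<in> U1 \<and> y \<in> U2 \<and> x \<otimes> y \<in> U3}
      (\<lambda>(a, b). \<kappa>3 (inv_into U1 \<kappa>1 a \<otimes> inv_into U2 \<kappa>2 b))"
  using lie_group assms unfolding lie_group_def Let_def by fast+

text \<open>Intersections are preserved because charts are injective, so the condition that defines
  \<^const>\<open>mtop\<close> is a topology and \<^const>\<open>openin\<close> unfolds to it.\<close>

lemma openin_mtop:
  "openin (mtop Q) W \<longleftrightarrow> W \<subseteq> carrier Q \<and> (\<forall>(U, \<kappa>)\<in>atlas Q. open (\<kappa> ` (W \<inter> U)))"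
proof -
  have "istopology (\<lambda>W. W \<subseteq> carrier Q \<and> (\<forall>(U, \<kappa>)\<in>atlas Q. open (\<kappa> ` (W \<inter> U))))"
    unfolding istopology_def
  proof (intro conjI allI impI ballI, goal_cases)
    case (1 S T) then show ?case by auto
  next
    case (2 S T c)
    obtain U \<kappa> where c: "c = (U, \<kappa>)" by force
    have "\<kappa> ` (S \<inter> T \<inter> U) = \<kappa> ` (S \<inter> U) \<inter> \<kappa> ` (T \<inter> U)"
      using chart_inj[of U \<kappa>] 2 c by (auto simp: inj_on_def)
    then show ?case using 2 c by auto
  next
    case (3 K) then show ?case by auto
  next
    case (4 K c)
    obtain U \<kappa> where c: "c = (U, \<kappa>)" by force
    have "\<kappa> ` (\<Union>K \<inter> U) = (\<Union>S\<in>K. \<kappa> ` (S \<inter> U))" by auto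
    moreover have "open (\<kappa> ` (S \<inter> U))" if "S \<in> K" for S using 4 c that by fast
    ultimately show ?case using c by auto
  qed
  then show ?thesis unfolding mtop_def by (simp add: topology_inverse')
qed

lemma openin_chart: "(U, \<kappa>) \<in> atlas Q \<Longrightarrow> openin (mtop Q) U"
  unfolding openin_mtop using chart_subset chart_overlap_open by (fastforce simp: Int_commute)

lemma openin_chart_image: "openin (mtop Q) W \<Longrightarrow> (U, \<kappa>) \<in> atlas Q \<Longrightarrow> open (\<kappa> ` (W \<inter> U))"
  unfolding openin_mtop by auto

lemma openin_mtop_subset: "{W. openin (mtop Q) W} \<subseteq> Pow (carrier Q)"
  unfolding openin_mtop by auto

text \<open>Joint continuity of multiplication. Both one-sided translations are slices of it, obtained by
  freezing one coordinate.\<close>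

lemma mult_preimage_open:
  assumes U: "(U1, \<kappa>1) \<in> atlas Q" "(U2, \<kappa>2) \<in> atlas Q" and W: "openin (mtop Q) W"
  shows "open {(\<kappa>1 x, \<kappa>2 y) |x y. x \<in> U1 \<and> y \<in> U2 \<and> x \<otimes> y \<in> W}"
proof (subst open_subopen, intro ballI)
  fix z assume "z \<in> {(\<kappa>1 x, \<kappa>2 y) |x y. x \<in> U1 \<and> y \<in> U2 \<and> x \<otimes> y \<in> W}"
  then obtain x y where z: "z = (\<kappa>1 x, \<kappa>2 y)" and xy: "x \<in> U1" "y \<in> U2" "x \<otimes> y \<in> W" by auto
  obtain U3 \<kappa>3 where U3: "(U3, \<kappa>3) \<in> atlas Q" "x \<otimes> y \<in> U3"
    using chart_at[of "x \<otimes> y"] xy W unfolding openin_mtop by blast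
  let ?D = "{(\<kappa>1 x, \<kappa>2 y) |x y. x \<in> U1 \<and> y \<in> U2 \<and> x \<otimes> y \<in> U3}"
  let ?F = "\<lambda>(a, b). \<kappa>3 (inv_into U1 \<kappa>1 a \<otimes> inv_into U2 \<kappa>2 b)"
  have D: "open ?D" "smooth_on ?D ?F"
    by (rule mult_smooth_in_charts[OF U U3(1)])+
  have "continuous_on ?D ?F"
    using D(2)[unfolded smooth_on_def, rule_format, of 0] by (simp only: Ck_on.simps)
  then have "open (?D \<inter> ?F -` (\<kappa>3 ` (W \<inter> U3)))"
    by (rule continuous_open_preimage[OF _ D(1) openin_chart_image[OF W U3(1)]])
  moreover have "z \<in> ?D \<inter> ?F -` (\<kappa>3 ` (W \<inter> U3))"
    using xy U3 chart_inj[OF U(1)] chart_inj[OF U(2)] by (auto simp: z)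
  moreover have "?D \<inter> ?F -` (\<kappa>3 ` (W \<inter> U3)) \<subseteq> {(\<kappa>1 x, \<kappa>2 y) |x y. x \<in> U1 \<and> y \<in> U2 \<and> x \<otimes> y \<in> W}"
  proof
    fix w assume "w \<in> ?D \<inter> ?F -` (\<kappa>3 ` (W \<inter> U3))"
    then obtain x y v where *: "w = (\<kappa>1 x, \<kappa>2 y)" "x \<in> U1" "y \<in> U2" "x \<otimes> y \<in> U3"
      "\<kappa>3 (x \<otimes> y) = \<kappa>3 v" "v \<in> W" "v \<in> U3"
      using chart_inj[OF U(1)] chart_inj[OF U(2)] by auto
    then have "x \<otimes> y = v"
      using chart_inj[OF U3(1)] by (auto simp: inj_on_def)
    then show "w \<in> {(\<kappa>1 x, \<kappa>2 y) |x y. x \<in> U1 \<and> y \<in> U2 \<and> x \<otimes> y \<in> W}"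
      using * by auto
  qed
  ultimately show "\<exists>T. open T \<and> z \<in> T \<and> T \<subseteq> {(\<kappa>1 x, \<kappa>2 y) |x y. x \<in> U1 \<and> y \<in> U2 \<and> x \<otimes> y \<in> W}"
    by blast
qed

lemma open_slices:
  assumes "open D"
  shows "open {b. (c, b) \<in> D}" "open {a. (a, c) \<in> D}"
proof -
  have "open ((\<lambda>b. (c, b)) -` D)" "open ((\<lambda>a. (a, c)) -` D)"
    by (auto intro!: open_vimage assms continuous_intros)
  then show "open {b. (c, b) \<in> D}" "open {a. (a, c) \<in> D}"
    by (simp_all add: vimage_def)
qed

lemma translation_preimage_open:
  assumes g: "g \<in> carrier Q" and W: "openin (mtop Q) W"
  shows "openin (mtop Q) {x \<in> carrier Q. g \<otimes> x \<in> W}"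
    and "openin (mtop Q) {x \<in> carrier Q. x \<otimes> g \<in> W}"
proof -
  obtain V \<nu> where V: "(V, \<nu>) \<in> atlas Q" "g \<in> V" using chart_at[OF g] .
  have "open (\<kappa> ` ({x \<in> carrier Q. g \<otimes> x \<in> W} \<inter> U))"
    and "open (\<kappa> ` ({x \<in> carrier Q. x \<otimes> g \<in> W} \<inter> U))" if U: "(U, \<kappa>) \<in> atlas Q" for U \<kappa>
  proof -
    have "\<kappa> ` ({x \<in> carrier Q. g \<otimes> x \<in> W} \<inter> U) =
        {b. (\<nu> g, b) \<in> {(\<nu> x, \<kappa> y) |x y. x \<in> V \<and> y \<in> U \<and> x \<otimes> y \<in> W}}"
      using V(2) chart_inj[OF V(1)] chart_subset[OF U] by (auto simp: inj_on_def image_iff)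
    then show "open (\<kappa> ` ({x \<in> carrier Q. g \<otimes> x \<in> W} \<inter> U))"
      using open_slices(1)[OF mult_preimage_open[OF V(1) U W]] by simp
    have "\<kappa> ` ({x \<in> carrier Q. x \<otimes> g \<in> W} \<inter> U) =
        {b. (b, \<nu> g) \<in> {(\<kappa> x, \<nu> y) |x y. x \<in> U \<and> y \<in> V \<and> x \<otimes> y \<in> W}}"
      using V(2) chart_inj[OF V(1)] chart_subset[OF U] by (auto simp: inj_on_def image_iff)
    then show "open (\<kappa> ` ({x \<in> carrier Q. x \<otimes> g \<in> W} \<inter> U))"
      using open_slices(2)[OF mult_preimage_open[OF U V(1) W]] by simp
  qed
  then show "openin (mtop Q) {x \<in> carrier Q. g \<otimes> x \<in> W}"
    and "openin (mtop Q) {x \<in> carrier Q. x \<otimes> g \<in> W}"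
    unfolding openin_mtop by auto
qed

lemma translation_smooth_in_charts:
  assumes g: "g \<in> carrier Q" and U: "(U, \<kappa>) \<in> atlas Q" and U': "(U', \<kappa>') \<in> atlas Q"
  shows "open (\<kappa> ` {y \<in> U. g \<otimes> y \<in> U'})"
    and "Ck_on k (\<kappa> ` {y \<in> U. g \<otimes> y \<in> U'}) (\<lambda>b. \<kappa>' (g \<otimes> inv_into U \<kappa> b))"
    and "open (\<kappa> ` {y \<in> U. y \<otimes> g \<in> U'})"
    and "Ck_on k (\<kappa> ` {y \<in> U. y \<otimes> g \<in> U'}) (\<lambda>b. \<kappa>' (inv_into U \<kappa> b \<otimes> g))"
proof -
  have *: "\<kappa> ` {y \<in> U. g \<otimes> y \<in> U'} = \<kappa> ` ({x \<in> carrier Q. g \<otimes> x \<in> U'} \<inter> U)"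
    "\<kappa> ` {y \<in> U. y \<otimes> g \<in> U'} = \<kappa> ` ({x \<in> carrier Q. x \<otimes> g \<in> U'} \<inter> U)"
    using chart_subset[OF U] by blast+
  show L: "open (\<kappa> ` {y \<in> U. g \<otimes> y \<in> U'})" and R: "open (\<kappa> ` {y \<in> U. y \<otimes> g \<in> U'})"
    unfolding * by (intro openin_chart_image[OF _ U] translation_preimage_open openin_chart[OF U'] g)+
  obtain V \<nu> where V: "(V, \<nu>) \<in> atlas Q" "g \<in> V" using chart_at[OF g] .
  note D1 = mult_smooth_in_charts[OF V(1) U U'] and D2 = mult_smooth_in_charts[OF U V(1) U']
  have bl: "bounded_linear (\<lambda>b::'e. (0::'e, b))" "bounded_linear (\<lambda>b::'e. (b, 0::'e))"
    by (auto intro!: bounded_linear_intros)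
  have a1: "Ck_on k (\<kappa> ` {y \<in> U. g \<otimes> y \<in> U'}) (\<lambda>b. (\<nu> g, 0) + (0, b))"
    by (rule Ck_on_affine[OF bl(1) L])
  have a2: "Ck_on k (\<kappa> ` {y \<in> U. y \<otimes> g \<in> U'}) (\<lambda>b. (0, \<nu> g) + (b, 0))"
    by (rule Ck_on_affine[OF bl(2) R])
  have "Ck_on k (\<kappa> ` {y \<in> U. g \<otimes> y \<in> U'})
      (\<lambda>b. (\<lambda>(a, b). \<kappa>' (inv_into V \<nu> a \<otimes> inv_into U \<kappa> b)) ((\<nu> g, 0) + (0, b)))"
    by (rule Ck_on_compose[OF L D1(1) _ a1]) (use D1(2) V in \<open>auto simp: smooth_on_def\<close>)
  then show "Ck_on k (\<kappa> ` {y \<in> U. g \<otimes> y \<in> U'}) (\<lambda>b. \<kappa>' (g \<otimes> inv_into U \<kappa> b))"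
    using V chart_inj[OF V(1)] by simp
  have "Ck_on k (\<kappa> ` {y \<in> U. y \<otimes> g \<in> U'})
      (\<lambda>b. (\<lambda>(a, b). \<kappa>' (inv_into U \<kappa> a \<otimes> inv_into V \<nu> b)) ((0, \<nu> g) + (b, 0)))"
    by (rule Ck_on_compose[OF R D2(1) _ a2]) (use D2(2) V in \<open>auto simp: smooth_on_def\<close>)
  then show "Ck_on k (\<kappa> ` {y \<in> U. y \<otimes> g \<in> U'}) (\<lambda>b. \<kappa>' (inv_into U \<kappa> b \<otimes> g))"
    using V chart_inj[OF V(1)] by simp
qed

lemma smooth_fun_cong:
  assumes "\<And>x. x \<in> carrier Q \<Longrightarrow> f x = f' x"
  shows "smooth_fun Q f \<longleftrightarrow> smooth_fun Q f'"
proof -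
  have "Ck_on k (\<kappa> ` U) (f \<circ> inv_into U \<kappa>) \<longleftrightarrow> Ck_on k (\<kappa> ` U) (f' \<circ> inv_into U \<kappa>)"
    if "(U, \<kappa>) \<in> atlas Q" for U \<kappa> k
    using that chart_subset[OF that] chart_inj[OF that]
    by (intro Ck_on_cong chart_image_open) (auto intro!: assms)
  then show ?thesis unfolding smooth_fun_def smooth_on_def by fastforce
qed

lemma smooth_fun_linear:
  assumes "smooth_fun Q f" "smooth_fun Q f'"
  shows "smooth_fun Q (\<lambda>x. a * f x + b * f' x)"
proof -
  have "Ck_on k (\<kappa> ` U) ((\<lambda>x. a * f x + b * f' x) \<circ> inv_into U \<kappa>)"
    if "(U, \<kappa>) \<in> atlas Q" for U \<kappa> k
  proof -
    have "Ck_on k (\<kappa> ` U) (f \<circ> inv_into U \<kappa>)" "Ck_on k (\<kappa> ` U) (f' \<circ> inv_into U \<kappa>)"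
      using assms that unfolding smooth_fun_def smooth_on_def by auto
    then show ?thesis
      unfolding o_def using chart_image_open[OF that]
      by (intro Ck_on_add Ck_on_bilinear[OF bounded_bilinear_mult] Ck_on_const)
  qed
  then show ?thesis unfolding smooth_fun_def smooth_on_def by auto
qed

text \<open>Smoothness is local: near a point \<open>y\<close> the translate is the expression of \<open>f\<close> in a chart around
  \<open>g y\<close> composed with the coordinate expression of the translation.\<close>

lemma smooth_fun_left_translate:
  assumes f: "smooth_fun Q f" and g: "g \<in> carrier Q"
  shows "smooth_fun Q (\<lambda>x. f (g \<otimes> x))"
proof -
  have "Ck_on k (\<kappa> ` U) ((\<lambda>x. f (g \<otimes> x)) \<circ> inv_into U \<kappa>)" if U: "(U, \<kappa>) \<in> atlas Q" for U \<kappa> k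
  proof (rule Ck_on_local)
    fix z assume "z \<in> \<kappa> ` U"
    then obtain y where y: "y \<in> U" "z = \<kappa> y" by auto
    obtain U' \<kappa>' where U': "(U', \<kappa>') \<in> atlas Q" "g \<otimes> y \<in> U'"
      using chart_at[of "g \<otimes> y"] g y chart_subset[OF U] by blast
    note T = translation_smooth_in_charts(1,2)[OF g U U'(1)]
    let ?T = "\<kappa> ` {y \<in> U. g \<otimes> y \<in> U'}"
    have "Ck_on k (\<kappa>' ` U') (f \<circ> inv_into U' \<kappa>')"
      using f U' unfolding smooth_fun_def smooth_on_def by fast
    then have "Ck_on k ?T (\<lambda>b. (f \<circ> inv_into U' \<kappa>') (\<kappa>' (g \<otimes> inv_into U \<kappa> b)))"
      by (rule Ck_on_compose[OF T(1) chart_image_open[OF U'(1)] _ T(2)]) (use chart_inj[OF U] in auto)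
    then have "Ck_on k ?T ((\<lambda>x. f (g \<otimes> x)) \<circ> inv_into U \<kappa>)"
      by (subst Ck_on_cong[OF T(1)]) (use chart_inj[OF U] chart_inj[OF U'(1)] in auto)
    then show "\<exists>T. open T \<and> z \<in> T \<and> Ck_on k T ((\<lambda>x. f (g \<otimes> x)) \<circ> inv_into U \<kappa>)"
      using T(1) y U' by blast
  qed
  then show ?thesis unfolding smooth_fun_def smooth_on_def by auto
qed

abbreviation borelG :: "'g measure" where
  "borelG \<equiv> sigma (carrier Q) {W. openin (mtop Q) W}"

lemma space_borelG [simp]: "space borelG = carrier Q"
  by (simp add: space_measure_of[OF openin_mtop_subset])

lemma left_translate_measurable:
  assumes "g \<in> carrier Q"
  shows "(\<lambda>x. g \<otimes> x) \<in> borelG \<rightarrow>\<^sub>M borelG"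
proof (rule measurable_measure_of[OF openin_mtop_subset])
  fix W assume "W \<in> {W. openin (mtop Q) W}"
  then have "openin (mtop Q) {x \<in> carrier Q. g \<otimes> x \<in> W}"
    using assms translation_preimage_open by auto
  moreover have "(\<lambda>x. g \<otimes> x) -` W \<inter> space borelG = {x \<in> carrier Q. g \<otimes> x \<in> W}" by auto
  ultimately show "(\<lambda>x. g \<otimes> x) -` W \<inter> space borelG \<in> sets borelG"
    by (auto simp: sets_measure_of[OF openin_mtop_subset])
qed (use assms in auto)

lemma borel_fun_left_translate:
  assumes "borel_fun Q f" "g \<in> carrier Q"
  shows "borel_fun Q (\<lambda>x. f (g \<otimes> x))"
  using measurable_compose[OF left_translate_measurable[OF assms(2)]] assms(1)
  unfolding borel_fun_def .

lemma borel_fun_cong: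
  assumes "\<And>x. x \<in> carrier Q \<Longrightarrow> f x = f' x"
  shows "borel_fun Q f \<longleftrightarrow> borel_fun Q f'"
  unfolding borel_fun_def by (rule measurable_cong) (simp add: assms)

section \<open>The adjoint action\<close>

abbreviation dom1 where "dom1 \<equiv> fst (chart1 Q)"

lemma chart1: "(dom1, coord Q) \<in> atlas Q" "\<one> \<in> dom1"
proof -
  have "\<exists>c. c \<in> atlas Q \<and> \<one> \<in> fst c"
    using chart_at[OF one_closed] by (metis fst_conv)
  from someI_ex[OF this] show "(dom1, coord Q) \<in> atlas Q" "\<one> \<in> dom1"
    unfolding coord_def chart1_def by auto
qed

lemma uncoord: "uncoord Q = inv_into dom1 (coord Q)"
  by (simp add: uncoord_def coord_def)

lemma uncoord_coord [simp]: "x \<in> dom1 \<Longrightarrow> uncoord Q (coord Q x) = x"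
  by (simp add: uncoord chart_inj[OF chart1(1)])

lemma U1_carrier: "x \<in> dom1 \<Longrightarrow> x \<in> carrier Q"
  using chart_subset[OF chart1(1)] by auto

lemma frechet_derivative_cong_open:
  assumes "open T" "x \<in> T" "\<And>a. a \<in> T \<Longrightarrow> f a = f' a"
  shows "frechet_derivative f (at x) = frechet_derivative f' (at x)"
proof -
  have "(f has_derivative D) (at x) \<longleftrightarrow> (f' has_derivative D) (at x)" for D
    by (metis assms has_derivative_transform_within_open)
  then show ?thesis unfolding frechet_derivative_def by simp
qed

text \<open>Near the identity the coordinate parametrization takes values in the group, so only values on
  \<^term>\<open>carrier Q\<close> matter.\<close>

lemma diff1_cong:
  assumes "\<And>x. x \<in> carrier Q \<Longrightarrow> f x = f' x"
  shows "diff1 Q f X = diff1 Q f' X"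
  unfolding diff1_def
  by (subst frechet_derivative_cong_open[OF chart_image_open[OF chart1(1)], where f' = "\<lambda>a. f' (uncoord Q a)"])
    (use chart1 in \<open>auto simp: U1_carrier assms\<close>)

text \<open>Conjugation is \<open>x \<mapsto> g x\<close> followed by \<open>y \<mapsto> y g\<^sup>-\<^sup>1\<close>. It is differentiated through a chart around \<open>g\<close>,
  because the intermediate point may leave the chart at the identity.\<close>

lemma has_derivative_Ad:
  assumes g: "g \<in> carrier Q"
  shows "((\<lambda>a. coord Q (g \<otimes> uncoord Q a \<otimes> inv g)) has_derivative Ad Q g) (at (coord Q \<one>))"
proof -
  obtain V \<nu> where V: "(V, \<nu>) \<in> atlas Q" "g \<in> V" using chart_at[OF g] .
  note L = translation_smooth_in_charts(1)[OF g chart1(1) V(1)]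
    translation_smooth_in_charts(2)[OF g chart1(1) V(1), of "Suc 0", folded uncoord]
  note R = translation_smooth_in_charts(4)[OF inv_closed[OF g] V(1) chart1(1), of "Suc 0"]
  let ?l = "\<lambda>b. \<nu> (g \<otimes> uncoord Q b)" and ?r = "\<lambda>b. coord Q (inv_into V \<nu> b \<otimes> inv g)"
  let ?T = "coord Q ` {y \<in> dom1. g \<otimes> y \<in> V}"
  have 1: "coord Q \<one> \<in> ?T" using chart1 V g by auto
  have l1: "?l (coord Q \<one>) = \<nu> g" using chart1 g by simp
  have "(?l has_derivative frechet_derivative ?l (at (coord Q \<one>))) (at (coord Q \<one>))"
    by (rule Ck_on_SucD[OF L(2) 1])
  moreover have "(?r has_derivative frechet_derivative ?r (at (\<nu> g))) (at (?l (coord Q \<one>)))"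
    unfolding l1 by (rule Ck_on_SucD[OF R]) (use V g chart1 in auto)
  ultimately have "((\<lambda>a. ?r (?l a)) has_derivative
      (\<lambda>v. frechet_derivative ?r (at (\<nu> g)) (frechet_derivative ?l (at (coord Q \<one>)) v))) (at (coord Q \<one>))"
    by (rule has_derivative_compose)
  then have "((\<lambda>a. coord Q (g \<otimes> uncoord Q a \<otimes> inv g)) has_derivative
      (\<lambda>v. frechet_derivative ?r (at (\<nu> g)) (frechet_derivative ?l (at (coord Q \<one>)) v))) (at (coord Q \<one>))"
    by (rule has_derivative_transform_within_open[OF _ L(1) 1])
      (use chart_inj[OF V(1)] in auto)
  then have "(\<lambda>a. coord Q (g \<otimes> uncoord Q a \<otimes> inv g)) differentiable at (coord Q \<one>)"
    by (auto simp: differentiable_def)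
  then show ?thesis
    by (simp add: frechet_derivative_works Ad_def diff1_def[abs_def])
qed

lemma Ad_one: "Ad Q \<one> X = X"
proof -
  have "((\<lambda>a. a) has_derivative (\<lambda>v. v)) (at (coord Q \<one>))" by simp
  then have "((\<lambda>a. coord Q (\<one> \<otimes> uncoord Q a \<otimes> inv \<one>)) has_derivative (\<lambda>v. v)) (at (coord Q \<one>))"
    by (rule has_derivative_transform_within_open[OF _ chart_image_open[OF chart1(1)]])
      (use chart1 in \<open>auto simp: U1_carrier\<close>)
  from has_derivative_unique[OF has_derivative_Ad[OF one_closed] this] show ?thesis by simp
qed

text \<open>Chain rule for \<open>x \<mapsto> h x h\<^sup>-\<^sup>1\<close> followed by conjugation with \<open>g\<close>.\<close>

lemma Ad_mult:
  assumes g: "g \<in> carrier Q" and h: "h \<in> carrier Q"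
  shows "Ad Q (g \<otimes> h) X = Ad Q g (Ad Q h X)"
proof -
  let ?c = "\<lambda>g a. coord Q (g \<otimes> uncoord Q a \<otimes> inv g)"
  let ?W = "{x \<in> carrier Q. h \<otimes> x \<in> {x \<in> carrier Q. x \<otimes> inv h \<in> dom1}}"
  \<comment> \<open>The coordinate expressions compose only where \<open>h x h\<^sup>-\<^sup>1\<close> stays in the chart.\<close>
  have W: "open (coord Q ` (?W \<inter> dom1))"
    by (intro openin_chart_image[OF _ chart1(1)] translation_preimage_open h inv_closed openin_chart[OF chart1(1)])
  have h1: "?c h (coord Q \<one>) = coord Q \<one>" using chart1 h by simp
  have "((\<lambda>a. ?c g (?c h a)) has_derivative (\<lambda>v. Ad Q g (Ad Q h v))) (at (coord Q \<one>))"
    by (rule has_derivative_compose[OF has_derivative_Ad[OF h]]) (simp only: h1 has_derivative_Ad[OF g])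
  then have "(?c (g \<otimes> h) has_derivative (\<lambda>v. Ad Q g (Ad Q h v))) (at (coord Q \<one>))"
    by (rule has_derivative_transform_within_open[OF _ W])
      (use chart1 g h in \<open>auto simp: inv_mult_group m_assoc\<close>)
  from has_derivative_unique[OF has_derivative_Ad[OF m_closed[OF g h]] this] show ?thesis by simp
qed

lemma left_deriv_left_translate:
  assumes "g \<in> carrier Q" "h \<in> carrier Q"
  shows "left_deriv Q X (\<lambda>x. f (g \<otimes> x)) h = left_deriv Q X f (g \<otimes> h)"
  unfolding left_deriv_def by (rule diff1_cong) (simp add: assms m_assoc)

lemma left_deriv_cong:
  assumes "\<And>x. x \<in> carrier Q \<Longrightarrow> f x = f' x" "g \<in> carrier Q"
  shows "left_deriv Q X f g = left_deriv Q X f' g"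
  unfolding left_deriv_def by (rule diff1_cong) (simp add: assms)

lemma left_deriv_linear:
  assumes f: "smooth_fun Q f" and f': "smooth_fun Q f'" and g: "g \<in> carrier Q"
  shows "left_deriv Q X (\<lambda>x. a * f x + b * f' x) g = a * left_deriv Q X f g + b * left_deriv Q X f' g"
proof -
  have *: "((\<lambda>a. f (g \<otimes> uncoord Q a)) has_derivative
      frechet_derivative (\<lambda>a. f (g \<otimes> uncoord Q a)) (at (coord Q \<one>))) (at (coord Q \<one>))"
    if "smooth_fun Q f" for f
  proof (rule Ck_on_SucD[where k = 0 and S = "coord Q ` dom1"])
    show "Ck_on (Suc 0) (coord Q ` dom1) (\<lambda>a. f (g \<otimes> uncoord Q a))"
      using smooth_fun_left_translate[OF that g] chart1(1)
      unfolding smooth_fun_def smooth_on_def uncoord o_def by blast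
  qed (use chart1 in auto)
  note has_derivative_add[OF has_derivative_mult_right[OF *[OF f], of a]
      has_derivative_mult_right[OF *[OF f'], of b]]
  from frechet_derivative_at[OF this, symmetric] show ?thesis
    by (simp add: left_deriv_def diff1_def)
qed

end

section \<open>The coadjoint orbit\<close>

locale kostant_souriau =
  fixes Q :: "('g, 'e::euclidean_space) quantum_data" (structure)
  assumes ks: "kostant_souriau_data Q"
begin

sublocale lie_group_context Q
  using ks by unfold_locales (simp add: kostant_souriau_data_def)

abbreviation pt :: "'g \<Rightarrow> ('e \<Rightarrow> real)" where
  "pt g \<equiv> coad Q g (covec Q)"

lemma coad_one: "coad Q \<one> \<xi> = \<xi>"
  by (simp add: coad_def Ad_one)

lemma coad_mult:
  "g \<in> carrier Q \<Longrightarrow> h \<in> carrier Q \<Longrightarrow> coad Q (g \<otimes> h) \<xi> = coad Q g (coad Q h \<xi>)"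
  by (simp add: coad_def Ad_mult inv_mult_group)

lemma coad_inv_coad: "g \<in> carrier Q \<Longrightarrow> coad Q (inv g) (coad Q g \<xi>) = \<xi>"
  and coad_coad_inv: "g \<in> carrier Q \<Longrightarrow> coad Q g (coad Q (inv g) \<xi>) = \<xi>"
  by (simp_all add: coad_mult[symmetric] coad_one)

lemma orbitE:
  assumes "x \<in> orbit Q"
  obtains g where "g \<in> carrier Q" "x = pt g"
  using assms unfolding orbit_def by auto

lemma pt_in_orbit [simp]: "g \<in> carrier Q \<Longrightarrow> pt g \<in> orbit Q"
  unfolding orbit_def by auto

lemma coad_in_orbit [simp]:
  assumes "g \<in> carrier Q" "x \<in> orbit Q"
  shows "coad Q g x \<in> orbit Q"
  using assms by (auto elim!: orbitE simp: coad_mult[symmetric])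

lemma stab_carrier: "h \<in> stab Q \<Longrightarrow> h \<in> carrier Q"
  by (simp add: stab_def)

lemma pt_eq_iff:
  assumes "a \<in> carrier Q" "g \<in> carrier Q"
  shows "pt a = pt g \<longleftrightarrow> inv a \<otimes> g \<in> stab Q"
proof
  assume "pt a = pt g"
  then have "coad Q (inv a) (pt a) = coad Q (inv a) (pt g)" by simp
  then show "inv a \<otimes> g \<in> stab Q"
    using assms by (simp add: coad_inv_coad coad_mult stab_def)
next
  assume "inv a \<otimes> g \<in> stab Q"
  then have "coad Q a (coad Q (inv a) (pt g)) = pt a"
    using assms by (simp add: stab_def coad_mult)
  then show "pt a = pt g" using assms by (simp add: coad_coad_inv)
qed

lemma stab_one: "\<one> \<in> stab Q"
  by (simp add: stab_def coad_one)

lemma chr_mult: "h \<in> stab Q \<Longrightarrow> k \<in> stab Q \<Longrightarrow> chr Q (h \<otimes> k) = chr Q h * chr Q k"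
  and chr_norm: "h \<in> stab Q \<Longrightarrow> cmod (chr Q h) = 1"
  using ks by (simp_all add: kostant_souriau_data_def prequantum_character_def)

lemma chr_one: "chr Q \<one> = 1"
  using chr_mult[OF stab_one stab_one] chr_norm[OF stab_one] by auto

text \<open>The ratio of the fibre coordinates of one point of the bundle with respect to two group elements
  \<open>a\<close> and \<open>g\<close> over the same point of the orbit: \<open>[g, v] = [a, \<eta>(a\<^sup>-\<^sup>1 g) v]\<close>.\<close>

abbreviation transition :: "'g \<Rightarrow> 'g \<Rightarrow> complex" where
  "transition a g \<equiv> chr Q (inv a \<otimes> g)"

lemma transition_norm:
  "a \<in> carrier Q \<Longrightarrow> g \<in> carrier Q \<Longrightarrow> pt a = pt g \<Longrightarrow> cmod (transition a g) = 1"
  by (simp add: pt_eq_iff chr_norm)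

lemma transition_mult:
  assumes "a \<in> carrier Q" "b \<in> carrier Q" "g \<in> carrier Q" "pt a = pt b" "pt b = pt g"
  shows "transition a b * transition b g = transition a g"
proof -
  have "transition a b * transition b g = chr Q ((inv a \<otimes> b) \<otimes> (inv b \<otimes> g))"
    using assms by (intro chr_mult[symmetric]) (simp_all add: pt_eq_iff[symmetric])
  also have "(inv a \<otimes> b) \<otimes> (inv b \<otimes> g) = (inv a \<otimes> b \<otimes> inv b) \<otimes> g"
    using assms by (intro m_assoc[symmetric]) auto
  also have "inv a \<otimes> b \<otimes> inv b = inv a"
    using assms by (simp add: m_assoc)
  finally show ?thesis .
qed

lemma transition_cnj:
  assumes "a \<in> carrier Q" "g \<in> carrier Q" "pt a = pt g"
  shows "cnj (transition a g) * transition a g = 1"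
  using transition_norm[OF assms] complex_norm_square[of "transition a g"]
  by (simp add: mult.commute)

section \<open>The line bundle\<close>

lemma mem_lcls:
  assumes "g \<in> carrier Q"
  shows "(a, w) \<in> lcls Q g v \<longleftrightarrow> a \<in> carrier Q \<and> pt a = pt g \<and> w = transition a g * v"
proof
  assume "(a, w) \<in> lcls Q g v"
  then obtain h where h: "h \<in> stab Q" "a = g \<otimes> h" "w = chr Q (inv h) * v"
    by (auto simp: lcls_def)
  moreover have "pt a = pt g" using h assms by (simp add: coad_mult stab_def)
  moreover have "inv a \<otimes> g = inv h"
    using h assms stab_carrier by (simp add: inv_mult_group m_assoc)
  ultimately show "a \<in> carrier Q \<and> pt a = pt g \<and> w = transition a g * v"
    using assms stab_carrier by simp
next
  assume *: "a \<in> carrier Q \<and> pt a = pt g \<and> w = transition a g * v"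
  then have "inv g \<otimes> a \<in> stab Q" using assms pt_eq_iff[of g a] by simp
  moreover have "g \<otimes> (inv g \<otimes> a) = a" "inv (inv g \<otimes> a) = inv a \<otimes> g"
    using * assms by (simp_all add: m_assoc[symmetric] inv_mult_group)
  ultimately show "(a, w) \<in> lcls Q g v"
    unfolding lcls_def using * by (intro CollectI exI[of _ "inv g \<otimes> a"]) auto
qed

lemma lcls_change_representative:
  assumes "a \<in> carrier Q" "g \<in> carrier Q" "pt a = pt g"
  shows "lcls Q g v = lcls Q a (transition a g * v)"
  using assms transition_mult[of _ a g]
  by (auto simp: mem_lcls mult.assoc[symmetric])

lemma lcls_eq_iff:
  assumes "g \<in> carrier Q"
  shows "lcls Q g v = lcls Q g w \<longleftrightarrow> v = w"
proof
  assume "lcls Q g v = lcls Q g w"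
  moreover have "(g, v) \<in> lcls Q g v" using assms by (simp add: mem_lcls chr_one)
  ultimately show "v = w" using assms by (simp add: mem_lcls chr_one)
qed simp

lemma lproj_lcls:
  assumes "g \<in> carrier Q"
  shows "lproj Q (lcls Q g v) = pt g"
  unfolding lproj_def using assms
  by (intro the_equality) (auto simp: mem_lcls intro!: exI[of _ g])

lemma lscale_lcls:
  assumes "g \<in> carrier Q"
  shows "lscale z (lcls Q g v) = lcls Q g (z * v)"
proof -
  have "(a, w) \<in> lscale z (lcls Q g v) \<longleftrightarrow> (\<exists>w'. (a, w') \<in> lcls Q g v \<and> w = z * w')" for a w
    unfolding lscale_def by force
  then show ?thesis using assms by (auto simp: mem_lcls)
qed

lemma ladd_lcls:
  assumes "g \<in> carrier Q"
  shows "ladd (lcls Q g v) (lcls Q g w) = lcls Q g (v + w)"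
  using assms unfolding ladd_def by (auto simp: mem_lcls algebra_simps)

lemma lherm_lcls:
  assumes "g \<in> carrier Q"
  shows "lherm (lcls Q g v) (lcls Q g w) = cnj v * w"
  unfolding lherm_def
proof (rule the_equality)
  show "\<exists>a v' w'. (a, v') \<in> lcls Q g v \<and> (a, w') \<in> lcls Q g w \<and> cnj v * w = cnj v' * w'"
    using assms by (intro exI[of _ g] exI[of _ v] exI[of _ w]) (simp add: mem_lcls chr_one)
next
  fix z assume "\<exists>a v' w'. (a, v') \<in> lcls Q g v \<and> (a, w') \<in> lcls Q g w \<and> z = cnj v' * w'"
  then obtain a where a: "a \<in> carrier Q" "pt a = pt g"
      and z: "z = cnj (transition a g * v) * (transition a g * w)"
    using assms by (auto simp: mem_lcls)
  have "z = (cnj (transition a g) * transition a g) * (cnj v * w)"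
    by (simp add: z)
  then show "z = cnj v * w" using transition_cnj[OF a(1) assms a(2)] by simp
qed

lemma lact_lcls:
  assumes "a \<in> carrier Q" "g \<in> carrier Q"
  shows "lact Q a (lcls Q g v) = lcls Q (a \<otimes> g) v"
  unfolding lact_def lcls_def using assms stab_carrier
  by (force simp: m_assoc image_iff)

lemma lbundle0E:
  assumes "q \<in> lbundle0 Q"
  obtains g v where "g \<in> carrier Q" "v \<noteq> 0" "q = lcls Q g v"
  using assms unfolding lbundle0_def by auto

section \<open>Sections as functions\<close>

lemma lift_eqI:
  assumes "g \<in> carrier Q" "s (pt g) = lcls Q g v"
  shows "lift Q s g = v"
  unfolding lift_def assms(2) using assms(1)
  by (intro the_equality) (simp_all add: mem_lcls chr_one)

lemma section_at:
  assumes "s \<in> lsections Q" "g \<in> carrier Q"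
  shows "s (pt g) = lcls Q g (lift Q s g)"
proof -
  have "s (pt g) \<in> lbundle Q" "lproj Q (s (pt g)) = pt g"
    using assms unfolding lsections_def by auto
  then obtain a v where a: "a \<in> carrier Q" "s (pt g) = lcls Q a v" "pt a = pt g"
    unfolding lbundle_def by (auto simp: lproj_lcls)
  then have "s (pt g) = lcls Q g (transition g a * v)"
    using assms lcls_change_representative[of g a v] by simp
  with lift_eqI[where s = s, OF assms(2) this] show ?thesis by simp
qed

lemma lift_equivariant:
  assumes "s \<in> lsections Q" "a \<in> carrier Q" "g \<in> carrier Q" "pt a = pt g"
  shows "lift Q s a = transition a g * lift Q s g"
  using section_at[OF assms(1,3)] lcls_change_representative[OF assms(2-4)] assms
  by (intro lift_eqI) simp_all

lemma lsections_eqI: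
  assumes "s \<in> lsections Q" "s' \<in> lsections Q" "\<And>g. g \<in> carrier Q \<Longrightarrow> lift Q s g = lift Q s' g"
  shows "s = s'"
proof
  fix x
  show "s x = s' x"
  proof (cases "x \<in> orbit Q")
    case True
    then show ?thesis using assms by (auto elim!: orbitE simp: section_at)
  next
    case False
    then show ?thesis using assms unfolding lsections_def by (auto simp: PiE_def extensional_def)
  qed
qed

lemma lcls_in_fibre:
  "g \<in> carrier Q \<Longrightarrow> lcls Q g v \<in> lbundle Q \<and> lproj Q (lcls Q g v) = pt g"
  by (auto simp: lproj_lcls lbundle_def)

text \<open>A set-theoretic section of \<open>G \<rightarrow> G/H\<close>. It trivializes the line bundle, so sections become
  complex functions on the orbit and the Hermitian metric becomes \<open>cnj u * v\<close>. The choice may fail to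
  be measurable, so measurability of a section is expressed through its lift to the group.\<close>

definition rep :: "('e \<Rightarrow> real) \<Rightarrow> 'g" where
  "rep x = (SOME g. g \<in> carrier Q \<and> pt g = x)"

lemma rep: "x \<in> orbit Q \<Longrightarrow> rep x \<in> carrier Q" "x \<in> orbit Q \<Longrightarrow> pt (rep x) = x"
proof -
  assume "x \<in> orbit Q"
  then have "\<exists>g. g \<in> carrier Q \<and> pt g = x" by (auto elim: orbitE)
  from someI_ex[OF this] show "rep x \<in> carrier Q" "pt (rep x) = x"
    unfolding rep_def by auto
qed

definition triv :: "('g, 'e) sec \<Rightarrow> ('e \<Rightarrow> real) \<Rightarrow> complex" where
  "triv s x = lift Q s (rep x)"

definition untriv :: "(('e \<Rightarrow> real) \<Rightarrow> complex) \<Rightarrow> ('g, 'e) sec" where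
  "untriv u = (\<lambda>x\<in>orbit Q. lcls Q (rep x) (u x))"

lemma section_triv: "s \<in> lsections Q \<Longrightarrow> x \<in> orbit Q \<Longrightarrow> s x = lcls Q (rep x) (triv s x)"
  using section_at[of s "rep x"] by (simp add: rep triv_def)

lemma untriv_section [simp]: "untriv u \<in> lsections Q"
  unfolding untriv_def lsections_def using lcls_in_fibre by (auto simp: rep)

lemma triv_untriv [simp]: "x \<in> orbit Q \<Longrightarrow> triv (untriv u) x = u x"
  unfolding triv_def by (rule lift_eqI) (simp_all add: rep untriv_def)

lemma untriv_triv [simp]:
  assumes "s \<in> lsections Q"
  shows "untriv (triv s) = s"
proof
  fix x show "untriv (triv s) x = s x"
  proof (cases "x \<in> orbit Q")
    case True
    then show ?thesis by (simp add: untriv_def section_triv[OF assms])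
  next
    case False
    then show ?thesis using assms by (auto simp: untriv_def lsections_def PiE_def extensional_def)
  qed
qed

lemma untriv_cong: "(\<And>x. x \<in> orbit Q \<Longrightarrow> u x = u' x) \<Longrightarrow> untriv u = untriv u'"
  unfolding untriv_def by (rule restrict_ext) simp

lemma lift_untriv:
  assumes "g \<in> carrier Q"
  shows "lift Q (untriv u) g = transition g (rep (pt g)) * u (pt g)"
  using lift_equivariant[OF untriv_section assms, of "rep (pt g)" u] assms triv_untriv[of "pt g" u]
  by (simp add: rep triv_def)

lemma lift_triv:
  assumes "s \<in> lsections Q" "g \<in> carrier Q"
  shows "lift Q s g = transition g (rep (pt g)) * triv s (pt g)"
  using lift_untriv[OF assms(2), of "triv s"] assms by simp

lemma lherm_triv:
  assumes "s \<in> lsections Q" "s' \<in> lsections Q" "x \<in> orbit Q"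
  shows "lherm (s x) (s' x) = cnj (triv s x) * triv s' x"
  using assms by (simp add: section_triv lherm_lcls rep)

lemma lherm_lift:
  assumes "s \<in> lsections Q" "s' \<in> lsections Q" "g \<in> carrier Q"
  shows "lherm (s (pt g)) (s' (pt g)) = cnj (lift Q s g) * lift Q s' g"
  using assms by (simp add: section_at lherm_lcls)

lemma sscale_untriv:
  assumes "s \<in> lsections Q"
  shows "sscale Q z s = untriv (\<lambda>x. z * triv s x)"
  unfolding sscale_def untriv_def
  by (rule restrict_ext) (simp add: section_triv[OF assms] lscale_lcls rep)

lemma sdiff_untriv:
  assumes "s \<in> lsections Q" "s' \<in> lsections Q"
  shows "sdiff Q s s' = untriv (\<lambda>x. triv s x - triv s' x)"
  unfolding sdiff_def untriv_def
  by (rule restrict_ext) (simp add: section_triv assms lscale_lcls ladd_lcls rep)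

lemma sact_section [simp]:
  assumes "s \<in> lsections Q" "g \<in> carrier Q"
  shows "sact Q g s \<in> lsections Q"
  unfolding lsections_def
proof (rule PiE_I)
  fix x assume x: "x \<in> orbit Q"
  then obtain a where a: "a \<in> carrier Q" "x = pt a" by (auto elim: orbitE)
  then have "sact Q g s x = lcls Q a (lift Q s (inv g \<otimes> a))"
    using assms x section_at[of s "inv g \<otimes> a"]
    by (simp add: sact_def coad_mult[symmetric] lact_lcls m_assoc[symmetric])
  then show "sact Q g s x \<in> {q \<in> lbundle Q. lproj Q q = x}"
    using lcls_in_fibre[OF a(1)] a(2) by simp
qed (simp add: sact_def)

lemma lift_sact:
  assumes "s \<in> lsections Q" "g \<in> carrier Q" "a \<in> carrier Q"
  shows "lift Q (sact Q g s) a = lift Q s (inv g \<otimes> a)"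
  using assms section_at[of s "inv g \<otimes> a"]
  by (intro lift_eqI) (simp_all add: sact_def coad_mult[symmetric] lact_lcls m_assoc[symmetric])

lemma sact_inv_sact:
  assumes "s \<in> lsections Q" "g \<in> carrier Q"
  shows "sact Q g (sact Q (inv g) s) = s"
  using assms by (intro lsections_eqI) (simp_all add: lift_sact m_assoc[symmetric])

lemma ev_lcls:
  assumes "s \<in> lsections Q" "g \<in> carrier Q" "v \<noteq> 0"
  shows "ev Q (lcls Q g v) s = lift Q s g / v"
  unfolding ev_def using assms
  by (intro the_equality) (auto simp: lscale_lcls lproj_lcls section_at lcls_eq_iff field_simps)

section \<open>Measure theory on the orbit\<close>

lemma space_vol: "space (vol Q) = orbit Q"
  and sets_vol: "sets (vol Q) = orbit_borel Q"
  and vol_invariant: "g \<in> carrier Q \<Longrightarrow> B \<in> orbit_borel Q \<Longrightarrow>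
    emeasure (vol Q) (coad Q g ` B) = emeasure (vol Q) B"
  using ks by (simp_all add: kostant_souriau_data_def invariant_volume_def)

lemma mem_orbit_borel:
  "B \<in> orbit_borel Q \<longleftrightarrow> B \<subseteq> orbit Q \<and> {g \<in> carrier Q. pt g \<in> B} \<in> sets borelG"
  by (simp add: orbit_borel_def sets_measure_of[OF openin_mtop_subset])

text \<open>The \<open>\<sigma>\<close>-algebra of the orbit is the quotient one, so measurability can be tested on the group.\<close>

lemma measurable_on_orbit:
  assumes "borel_fun Q (\<lambda>g. w (pt g))"
  shows "w \<in> borel_measurable (vol Q)"
proof (rule measurableI)
  fix A :: "complex set" assume "A \<in> sets borel"
  then have "(\<lambda>g. w (pt g)) -` A \<inter> space borelG \<in> sets borelG"
    using assms unfolding borel_fun_def by (rule measurable_sets[rotated])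
  moreover have "(\<lambda>g. w (pt g)) -` A \<inter> space borelG = {g \<in> carrier Q. pt g \<in> w -` A \<inter> orbit Q}"
    by auto
  ultimately show "w -` A \<inter> space (vol Q) \<in> sets (vol Q)"
    by (simp add: sets_vol space_vol mem_orbit_borel)
qed simp

lemma coad_measurable:
  assumes "g \<in> carrier Q"
  shows "coad Q g \<in> vol Q \<rightarrow>\<^sub>M vol Q"
proof (rule measurableI)
  fix B assume "B \<in> sets (vol Q)"
  then have B: "{a \<in> carrier Q. pt a \<in> B} \<in> sets borelG"
    by (simp add: sets_vol mem_orbit_borel)
  have "(\<lambda>x. g \<otimes> x) -` {a \<in> carrier Q. pt a \<in> B} \<inter> space borelG =
      {a \<in> carrier Q. pt a \<in> coad Q g -` B \<inter> orbit Q}"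
    using assms by (auto simp: coad_mult)
  with measurable_sets[OF left_translate_measurable[OF assms] B]
  show "coad Q g -` B \<inter> space (vol Q) \<in> sets (vol Q)"
    by (simp add: sets_vol mem_orbit_borel space_vol)
qed (use assms in \<open>simp add: space_vol\<close>)

lemma distr_coad:
  assumes g: "g \<in> carrier Q"
  shows "distr (vol Q) (vol Q) (coad Q g) = vol Q"
proof (rule measure_eqI)
  fix B assume "B \<in> sets (distr (vol Q) (vol Q) (coad Q g))"
  then have B: "B \<in> sets (vol Q)" by simp
  then have "B \<subseteq> orbit Q" by (simp add: sets_vol mem_orbit_borel)
  \<comment> \<open>The invariance hypothesis speaks of images, a push-forward of preimages.\<close>
  have "coad Q g -` B \<inter> space (vol Q) = coad Q (inv g) ` B"
  proof (intro equalityI subsetI)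
    fix x assume "x \<in> coad Q g -` B \<inter> space (vol Q)"
    then show "x \<in> coad Q (inv g) ` B"
      using g by (intro image_eqI[of _ _ "coad Q g x"]) (simp_all add: coad_inv_coad)
  next
    fix x assume "x \<in> coad Q (inv g) ` B"
    then show "x \<in> coad Q g -` B \<inter> space (vol Q)"
      using g \<open>B \<subseteq> orbit Q\<close> by (auto simp: space_vol coad_coad_inv)
  qed
  then show "emeasure (distr (vol Q) (vol Q) (coad Q g)) B = emeasure (vol Q) B"
    using B g by (simp add: emeasure_distr[OF coad_measurable[OF g]] vol_invariant sets_vol)
qed simp

end

section \<open>Completeness and Riesz representation in \<open>L\<^sup>2\<close>\<close>

lemma linear_term_zero:
  fixes a b :: real
  assumes a: "0 \<le> a" and nonneg: "\<And>t. 0 \<le> t\<^sup>2 * a + 2 * t * b"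
  shows "b = 0"
proof -
  define s where "s = b / (a + 1)"
  have b: "b = s * (a + 1)" using a by (simp add: s_def)
  have "0 \<le> (- s)\<^sup>2 * a + 2 * (- s) * b" by (rule nonneg)
  also have "\<dots> = - (s\<^sup>2 * (a + 2))"
    unfolding b by (simp add: algebra_simps power2_eq_square)
  finally have "s\<^sup>2 * (a + 2) \<le> 0" by simp
  then have "s = 0" using a by (simp add: mult_le_0_iff)
  then show ?thesis using b by simp
qed

text \<open>Square-integrable sections of the line bundle, written in a trivialization that need not be
  measurable, may fail to be measurable functions, but their pairwise products are measurable. This locale keeps exactly what
  the proof that \<open>L\<^sup>2\<close> is complete uses: a class of functions closed under linear combinations and limits
  (extended by \<open>0\<close> where the limit does not exist), whose products are measurable. Vectors are functions,
  so that \<open>norm_sq\<close> is only the square of a seminorm.\<close>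

locale square_integrable_class =
  fixes M :: "'x measure" and \<M> :: "('x \<Rightarrow> complex) set"
  assumes linear_closed: "u \<in> \<M> \<Longrightarrow> v \<in> \<M> \<Longrightarrow> (\<lambda>x. a * u x + b * v x) \<in> \<M>"
    and limit_closed: "(\<And>n. w n \<in> \<M>) \<Longrightarrow>
      (\<lambda>x. if convergent (\<lambda>n. w n x) then lim (\<lambda>n. w n x) else 0) \<in> \<M>"
    and product_measurable: "u \<in> \<M> \<Longrightarrow> v \<in> \<M> \<Longrightarrow> (\<lambda>x. cnj (u x) * v x) \<in> borel_measurable M"
begin

definition L2 :: "('x \<Rightarrow> complex) set" where
  "L2 = {u \<in> \<M>. integrable M (\<lambda>x. (cmod (u x))\<^sup>2)}"

definition iprod :: "('x \<Rightarrow> complex) \<Rightarrow> ('x \<Rightarrow> complex) \<Rightarrow> complex" where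
  "iprod u v = (\<integral>x. cnj (u x) * v x \<partial>M)"

definition norm_sq :: "('x \<Rightarrow> complex) \<Rightarrow> real" where
  "norm_sq u = (\<integral>x. (cmod (u x))\<^sup>2 \<partial>M)"

lemma cmod_sq_measurable:
  assumes "u \<in> \<M>"
  shows "(\<lambda>x. (cmod (u x))\<^sup>2) \<in> borel_measurable M"
proof -
  have "(\<lambda>x. Re (cnj (u x) * u x)) \<in> borel_measurable M"
    by (intro measurable_compose[OF product_measurable[OF assms assms]] borel_measurable_Re)
  moreover have "Re (cnj (u x) * u x) = (cmod (u x))\<^sup>2" for x
    by (metis Re_complex_of_real complex_norm_square mult.commute)
  ultimately show ?thesis by simp
qed

lemma L2_M: "u \<in> L2 \<Longrightarrow> u \<in> \<M>"
  and L2_integrable: "u \<in> L2 \<Longrightarrow> integrable M (\<lambda>x. (cmod (u x))\<^sup>2)"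
  by (simp_all add: L2_def)

lemma integrable_product:
  assumes "u \<in> L2" "v \<in> L2"
  shows "integrable M (\<lambda>x. cnj (u x) * v x)"
proof (rule Bochner_Integration.integrable_bound)
  show "integrable M (\<lambda>x. (cmod (u x))\<^sup>2 + (cmod (v x))\<^sup>2)"
    using assms by (intro Bochner_Integration.integrable_add L2_integrable)
  show "(\<lambda>x. cnj (u x) * v x) \<in> borel_measurable M"
    by (intro product_measurable L2_M assms)
  have "a * b \<le> a\<^sup>2 + b\<^sup>2" for a b :: real
    using sum_squares_bound[of a b] zero_le_power2[of a] zero_le_power2[of b] by linarith
  then show "AE x in M. norm (cnj (u x) * v x) \<le> norm ((cmod (u x))\<^sup>2 + (cmod (v x))\<^sup>2)"
    by (simp add: norm_mult)
qed

lemma L2_linear: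
  assumes "u \<in> L2" "v \<in> L2"
  shows "(\<lambda>x. a * u x + b * v x) \<in> L2"
proof -
  have M: "(\<lambda>x. a * u x + b * v x) \<in> \<M>"
    using assms by (intro linear_closed L2_M)
  have "integrable M (\<lambda>x. (cmod (a * u x + b * v x))\<^sup>2)"
  proof (rule Bochner_Integration.integrable_bound)
    show "integrable M (\<lambda>x. 2 * (cmod a)\<^sup>2 * (cmod (u x))\<^sup>2 + 2 * (cmod b)\<^sup>2 * (cmod (v x))\<^sup>2)"
      using assms by (intro Bochner_Integration.integrable_add integrable_mult_right L2_integrable)
    show "(\<lambda>x. (cmod (a * u x + b * v x))\<^sup>2) \<in> borel_measurable M"
      by (rule cmod_sq_measurable[OF M])
    have "(cmod (p + q))\<^sup>2 \<le> 2 * (cmod p)\<^sup>2 + 2 * (cmod q)\<^sup>2" for p q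
    proof -
      have "(cmod (p + q))\<^sup>2 \<le> (cmod p + cmod q)\<^sup>2"
        by (intro power_mono norm_triangle_ineq) auto
      also have "\<dots> \<le> 2 * (cmod p)\<^sup>2 + 2 * (cmod q)\<^sup>2"
        using sum_squares_bound[of "cmod p" "cmod q"] by (simp add: power2_sum)
      finally show ?thesis .
    qed
    from this[of "a * u x" "b * v x" for x]
    show "AE x in M. norm ((cmod (a * u x + b * v x))\<^sup>2)
        \<le> norm (2 * (cmod a)\<^sup>2 * (cmod (u x))\<^sup>2 + 2 * (cmod b)\<^sup>2 * (cmod (v x))\<^sup>2)"
      by (simp add: norm_mult power_mult_distrib mult.assoc)
  qed
  with M show ?thesis by (simp add: L2_def)
qed

lemma L2_diff: "u \<in> L2 \<Longrightarrow> v \<in> L2 \<Longrightarrow> (\<lambda>x. u x - v x) \<in> L2"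
  using L2_linear[of u v 1 "-1"] by simp

lemma iprod_linear:
  assumes "w \<in> L2" "u \<in> L2" "v \<in> L2"
  shows "iprod w (\<lambda>x. a * u x + b * v x) = a * iprod w u + b * iprod w v"
proof -
  have "iprod w (\<lambda>x. a * u x + b * v x) = (\<integral>x. a * (cnj (w x) * u x) + b * (cnj (w x) * v x) \<partial>M)"
    unfolding iprod_def by (rule arg_cong[where f = "integral\<^sup>L M"]) (auto simp: algebra_simps)
  also have "\<dots> = a * iprod w u + b * iprod w v"
    unfolding iprod_def using assms integrable_product by simp
  finally show ?thesis .
qed

lemma iprod_cnj: "iprod v u = cnj (iprod u v)"
  using Bochner_Integration.integral_cnj[of M "\<lambda>x. cnj (u x) * v x"] unfolding iprod_def by (simp add: mult.commute)

lemma iprod_linear_left: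
  assumes "w \<in> L2" "u \<in> L2" "v \<in> L2"
  shows "iprod (\<lambda>x. a * u x + b * v x) w = cnj a * iprod u w + cnj b * iprod v w"
  using arg_cong[OF iprod_linear[OF assms, of a b], of cnj]
  by (simp add: iprod_cnj[of w])

lemma iprod_self: "iprod u u = of_real (norm_sq u)"
proof -
  have "cnj (u x) * u x = of_real ((cmod (u x))\<^sup>2)" for x
    by (metis complex_norm_square mult.commute)
  then show ?thesis
    unfolding iprod_def norm_sq_def by (simp only: integral_complex_of_real)
qed

lemma norm_sq_nonneg: "0 \<le> norm_sq u"
  unfolding norm_sq_def by simp

lemma norm_sq_linear:
  assumes "u \<in> L2" "v \<in> L2"
  shows "norm_sq (\<lambda>x. a * u x + b * v x)
    = (cmod a)\<^sup>2 * norm_sq u + (cmod b)\<^sup>2 * norm_sq v + 2 * Re (cnj a * b * iprod u v)"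
proof -
  let ?w = "\<lambda>x. a * u x + b * v x"
  have "iprod ?w ?w = a * (cnj a * iprod u u + cnj b * iprod v u) + b * (cnj a * iprod u v + cnj b * iprod v v)"
    using assms by (simp add: iprod_linear L2_linear iprod_linear_left)
  also have "\<dots> = (a * cnj a) * iprod u u + (b * cnj b) * iprod v v
      + (cnj a * b * iprod u v + cnj (cnj a * b * iprod u v))"
    by (simp add: iprod_cnj[of v u] algebra_simps)
  also have "\<dots> = of_real ((cmod a)\<^sup>2 * norm_sq u + (cmod b)\<^sup>2 * norm_sq v + 2 * Re (cnj a * b * iprod u v))"
    unfolding complex_norm_square[symmetric] iprod_self complex_add_cnj by simp
  finally show ?thesis
    unfolding iprod_self of_real_eq_iff .
qed

lemma norm_sq_scale: "norm_sq (\<lambda>x. a * u x) = (cmod a)\<^sup>2 * norm_sq u"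
  unfolding norm_sq_def by (simp add: norm_mult power_mult_distrib)

text \<open>The seminorm can vanish on nonzero functions, so \<open>norm_sq v = 0\<close> is a case of its own. Both cases come
  from the positivity of \<open>norm_sq (u + t v)\<close> along the complex line of multiples of \<open>cnj (iprod u v)\<close>.\<close>

lemma Cauchy_Schwarz:
  assumes "u \<in> L2" "v \<in> L2"
  shows "(cmod (iprod u v))\<^sup>2 \<le> norm_sq u * norm_sq v"
proof -
  let ?P = "(cmod (iprod u v))\<^sup>2"
  have *: "0 \<le> norm_sq u + s\<^sup>2 * ?P * norm_sq v - 2 * s * ?P" for s :: real
  proof -
    have "cnj (iprod u v) * iprod u v = of_real ?P"
      by (metis complex_norm_square mult.commute)
    then have "Re (cnj 1 * (- of_real s * cnj (iprod u v)) * iprod u v) = - s * ?P"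
      by (simp add: mult.assoc del: of_real_power)
    moreover have "(cmod (- of_real s * cnj (iprod u v)))\<^sup>2 = s\<^sup>2 * ?P"
      by (simp add: norm_mult power_mult_distrib)
    ultimately have "norm_sq (\<lambda>x. 1 * u x + (- of_real s * cnj (iprod u v)) * v x)
        = norm_sq u + s\<^sup>2 * ?P * norm_sq v - 2 * s * ?P"
      using norm_sq_linear[OF assms, of 1 "- of_real s * cnj (iprod u v)"] by simp
    then show ?thesis using norm_sq_nonneg by metis
  qed
  show ?thesis
  proof (cases "norm_sq v = 0")
    case True
    have "?P = 0"
    proof (rule ccontr)
      assume "?P \<noteq> 0"
      then have "2 * ((norm_sq u + 1) / (2 * ?P)) * ?P = norm_sq u + 1" by simp
      then show False using *[of "(norm_sq u + 1) / (2 * ?P)"] True by simp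
    qed
    then show ?thesis using True by simp
  next
    case False
    then have "norm_sq v > 0" using norm_sq_nonneg[of v] by simp
    then show ?thesis using *[of "1 / norm_sq v"] by (simp add: field_simps power2_eq_square)
  qed
qed

lemma iprod_tendsto:
  assumes "\<And>n. w n \<in> L2" "e \<in> L2" "v \<in> L2" "(\<lambda>n. norm_sq (\<lambda>x. w n x - e x)) \<longlonglongrightarrow> 0"
  shows "(\<lambda>n. iprod v (w n)) \<longlonglongrightarrow> iprod v e"
proof (rule LIM_zero_cancel, rule Lim_null_comparison)
  show "\<forall>\<^sub>F n in sequentially. norm (iprod v (w n) - iprod v e) \<le> sqrt (norm_sq v * norm_sq (\<lambda>x. w n x - e x))"
  proof (intro always_eventually allI)
    fix n
    have "iprod v (\<lambda>x. w n x - e x) = iprod v (w n) - iprod v e"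
      using iprod_linear[OF assms(3) assms(1)[of n] assms(2), of 1 "-1"] by simp
    then show "norm (iprod v (w n) - iprod v e) \<le> sqrt (norm_sq v * norm_sq (\<lambda>x. w n x - e x))"
      using Cauchy_Schwarz[OF assms(3) L2_diff[OF assms(1)[of n] assms(2)]]
      by (simp add: real_le_rsqrt)
  qed
  show "(\<lambda>n. sqrt (norm_sq v * norm_sq (\<lambda>x. w n x - e x))) \<longlonglongrightarrow> 0"
    using tendsto_real_sqrt[OF tendsto_mult_right_zero[OF assms(4), of "norm_sq v"]] by simp
qed

lemma nn_integral_norm_sq:
  assumes "u \<in> L2"
  shows "(\<integral>\<^sup>+x. ennreal ((cmod (u x))\<^sup>2) \<partial>M) = ennreal (norm_sq u)"
  unfolding norm_sq_def using L2_integrable[OF assms] by (intro nn_integral_eq_integral) auto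

text \<open>If the increments \<open>\<Delta>\<^sub>n\<close> have squared norm at most \<open>C / 16\<^sup>n\<close>, then \<open>\<Sum> 4\<^sup>n |\<Delta>\<^sub>n|\<^sup>2\<close> has a finite
  integral and is finite almost everywhere; there \<open>2 |\<Delta>\<^sub>n| \<le> 4\<^sup>n |\<Delta>\<^sub>n|\<^sup>2 + 4\<^sup>-\<^sup>n\<close> is summable. The
  weights are chosen so that both series converge.\<close>

lemma fast_Cauchy_AE_convergent:
  assumes u: "\<And>n. u n \<in> L2" and C: "0 \<le> C"
    and fast: "\<And>n. norm_sq (\<lambda>x. u (Suc n) x - u n x) \<le> C / 16 ^ n"
  shows "AE x in M. convergent (\<lambda>n. u n x)"
proof -
  define d where "d n x = 4 ^ n * (cmod (u (Suc n) x - u n x))\<^sup>2" for n x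
  have d_meas: "(\<lambda>x. ennreal (d n x)) \<in> borel_measurable M" for n
    unfolding d_def using cmod_sq_measurable[OF L2_M[OF L2_diff[OF u u]]]
    by (intro measurable_compose[OF _ measurable_ennreal] borel_measurable_times) auto
  have "(\<integral>\<^sup>+x. ennreal (d n x) \<partial>M) \<le> ennreal (C * (1 / 4) ^ n)" for n
  proof -
    have "(\<integral>\<^sup>+x. ennreal (d n x) \<partial>M) = ennreal (4 ^ n) * ennreal (norm_sq (\<lambda>x. u (Suc n) x - u n x))"
      unfolding d_def ennreal_mult''[OF zero_le_power2]
      using cmod_sq_measurable[OF L2_M[OF L2_diff[OF u u]]]
      by (subst nn_integral_cmult) (auto simp: nn_integral_norm_sq[OF L2_diff[OF u u]])
    also have "\<dots> \<le> ennreal (4 ^ n) * ennreal (C / 16 ^ n)"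
      by (intro mult_left_mono ennreal_leI fast) auto
    also have "\<dots> = ennreal (4 ^ n * (C / 16 ^ n))"
      using C by (intro ennreal_mult''[symmetric]) simp
    also have "4 ^ n * (C / 16 ^ n) = C * (1 / 4) ^ n"
      using power_mult_distrib[of "4::real" 4 n] by (simp add: power_divide field_simps)
    finally show ?thesis .
  qed
  then have "(\<Sum>n. \<integral>\<^sup>+x. ennreal (d n x) \<partial>M) \<le> (\<Sum>n. ennreal (C * (1 / 4) ^ n))"
    by (intro suminf_le) auto
  also have "\<dots> = ennreal (\<Sum>n. C * (1 / 4) ^ n)"
    using C by (intro suminf_ennreal_eq summable_sums summable_mult summable_geometric) auto
  also have "\<dots> < \<infinity>" by simp
  finally have "(\<integral>\<^sup>+x. (\<Sum>n. ennreal (d n x)) \<partial>M) \<noteq> \<infinity>"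
    using d_meas by (simp add: nn_integral_suminf)
  then have "AE x in M. (\<Sum>n. ennreal (d n x)) \<noteq> \<infinity>"
    using d_meas by (intro nn_integral_PInf_AE) auto
  then show ?thesis
  proof (rule AE_mp, intro AE_I2 impI)
    fix x assume "(\<Sum>n. ennreal (d n x)) \<noteq> \<infinity>"
    then have "summable (\<lambda>n. d n x)"
      by (intro summable_suminf_not_top) (auto simp: d_def)
    moreover have "summable (\<lambda>n. (1 / 4 :: real) ^ n)"
      by (rule summable_geometric) simp
    ultimately have "summable (\<lambda>n. d n x + (1 / 4) ^ n)" by (rule summable_add)
    then have "summable (\<lambda>n. u (Suc n) x - u n x)"
    proof (rule summable_comparison_test')
      fix n
      let ?t = "cmod (u (Suc n) x - u n x)"
      have "2 * (2 ^ n * ?t) * (1 / 2) ^ n \<le> (2 ^ n * ?t)\<^sup>2 + ((1 / 2) ^ n)\<^sup>2"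
        by (rule sum_squares_bound)
      moreover have "2 * (2 ^ n * ?t) * (1 / 2) ^ n = 2 * ?t"
        by (simp add: power_divide)
      moreover have "(2 ^ n * ?t)\<^sup>2 + ((1 / 2) ^ n)\<^sup>2 = d n x + (1 / 4) ^ n"
        by (simp add: d_def power_mult_distrib power_even_eq power2_eq_square power_mult_distrib[symmetric])
      ultimately have "2 * ?t \<le> d n x + (1 / 4) ^ n" by simp
      moreover have "0 \<le> ?t" by simp
      ultimately show "norm (u (Suc n) x - u n x) \<le> d n x + (1 / 4) ^ n" by linarith
    qed
    then have "convergent (\<lambda>n. \<Sum>k<n. u (Suc k) x - u k x)"
      by (simp add: summable_iff_convergent)
    then have "convergent (\<lambda>n. (u n x - u 0 x) + u 0 x)"
      unfolding sum_lessThan_telescope[of "\<lambda>k. u k x"] by (intro convergent_add convergent_const)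
    then show "convergent (\<lambda>n. u n x)" by simp
  qed
qed

text \<open>Completeness of \<open>L\<^sup>2\<close> for rapidly Cauchy sequences. The limit exists almost everywhere by the
  previous lemma, and Fatou's lemma turns the bounds on \<open>u m - u n\<close> into bounds on \<open>e - u n\<close>.\<close>

lemma fast_Cauchy_complete:
  assumes u: "\<And>n. u n \<in> L2" and C: "0 \<le> C"
    and fast: "\<And>m n. n \<le> m \<Longrightarrow> norm_sq (\<lambda>x. u m x - u n x) \<le> C / 16 ^ n"
  shows "\<exists>e\<in>L2. \<forall>n. norm_sq (\<lambda>x. u n x - e x) \<le> C / 16 ^ n"
proof -
  define e where "e x = (if convergent (\<lambda>n. u n x) then lim (\<lambda>n. u n x) else 0)" for x
  have eM: "e \<in> \<M>"
    unfolding e_def using limit_closed[of u] L2_M[OF u] by simp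
  have diffM: "(\<lambda>x. u n x - e x) \<in> \<M>" for n
    using linear_closed[OF L2_M[OF u] eM, of 1 n "-1"] by simp
  have ae: "AE x in M. (\<lambda>m. u m x) \<longlonglongrightarrow> e x"
    using fast_Cauchy_AE_convergent[OF u C fast]
    by (rule AE_mp) (auto simp: e_def convergent_LIMSEQ_iff)
  have bound: "(\<integral>\<^sup>+x. ennreal ((cmod (u n x - e x))\<^sup>2) \<partial>M) \<le> ennreal (C / 16 ^ n)" for n
  proof -
    have "(\<integral>\<^sup>+x. ennreal ((cmod (u n x - e x))\<^sup>2) \<partial>M)
        = (\<integral>\<^sup>+x. liminf (\<lambda>i. ennreal ((cmod (u (n + i) x - u n x))\<^sup>2)) \<partial>M)"
    proof (rule nn_integral_cong_AE, rule AE_mp[OF ae], intro AE_I2 impI)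
      fix x assume "(\<lambda>m. u m x) \<longlonglongrightarrow> e x"
      then have "(\<lambda>i. u (i + n) x) \<longlonglongrightarrow> e x" by (rule LIMSEQ_ignore_initial_segment)
      then have "(\<lambda>i. ennreal ((cmod (u (n + i) x - u n x))\<^sup>2)) \<longlonglongrightarrow> ennreal ((cmod (e x - u n x))\<^sup>2)"
        by (intro tendsto_ennrealI tendsto_intros) (simp add: add.commute)
      from lim_imp_Liminf[OF _ this]
      show "ennreal ((cmod (u n x - e x))\<^sup>2) = liminf (\<lambda>i. ennreal ((cmod (u (n + i) x - u n x))\<^sup>2))"
        by (simp add: norm_minus_commute)
    qed
    also have "\<dots> \<le> liminf (\<lambda>i. \<integral>\<^sup>+x. ennreal ((cmod (u (n + i) x - u n x))\<^sup>2) \<partial>M)"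
      using cmod_sq_measurable[OF L2_M[OF L2_diff[OF u u]]]
      by (intro nn_integral_liminf measurable_compose[OF _ measurable_ennreal])
    also have "\<dots> = liminf (\<lambda>i. ennreal (norm_sq (\<lambda>x. u (n + i) x - u n x)))"
      by (simp add: nn_integral_norm_sq[OF L2_diff[OF u u]])
    also have "\<dots> \<le> liminf (\<lambda>i::nat. ennreal (C / 16 ^ n))"
      by (intro Liminf_mono always_eventually allI ennreal_leI fast) simp
    also have "\<dots> = ennreal (C / 16 ^ n)" by (simp add: Liminf_const)
    finally show ?thesis .
  qed
  have diffL2: "(\<lambda>x. u n x - e x) \<in> L2" for n
  proof -
    have "(\<integral>\<^sup>+x. ennreal (norm ((cmod (u n x - e x))\<^sup>2)) \<partial>M) < \<infinity>"
      using le_less_trans[OF bound[of n], of \<infinity>] by simp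
    then show ?thesis
      using cmod_sq_measurable[OF diffM[of n]] diffM[of n] by (simp add: L2_def integrable_iff_bounded)
  qed
  have "e \<in> L2" using L2_diff[OF u diffL2, of 0 0] by simp
  moreover have "norm_sq (\<lambda>x. u n x - e x) \<le> C / 16 ^ n" for n
    using bound[of n] C by (simp add: nn_integral_norm_sq[OF diffL2] ennreal_le_iff)
  ultimately show ?thesis by blast
qed

text \<open>The Riesz representation theorem for a functional that is bounded on a subspace \<open>V\<close> which need not be
  closed; the representing vector lies in the closure of \<open>V\<close>. The functional
  \<open>J u = norm_sq u - 2 Re (\<phi> u)\<close> is bounded below, and the parallelogram law makes every minimizing sequence
  a Cauchy sequence, as fast as the previous lemma requires if \<open>J\<close> approaches its infimum fast enough. The
  first variation of \<open>J\<close> at the limit vanishes, which says that the limit represents \<open>\<phi>\<close>.\<close>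

lemma Riesz_representation:
  assumes V: "V \<subseteq> L2" "V \<noteq> {}"
    and V_linear: "\<And>u v a b. u \<in> V \<Longrightarrow> v \<in> V \<Longrightarrow> (\<lambda>x. a * u x + b * v x) \<in> V"
    and \<phi>_linear: "\<And>u v a b. u \<in> V \<Longrightarrow> v \<in> V \<Longrightarrow>
      \<phi> (\<lambda>x. a * u x + b * v x) = a * \<phi> u + b * \<phi> v"
    and bounded: "\<And>u. u \<in> V \<Longrightarrow> cmod (\<phi> u) \<le> B * sqrt (norm_sq u)"
  obtains e w where "e \<in> L2" "\<And>n. w n \<in> V" "(\<lambda>n. norm_sq (\<lambda>x. w n x - e x)) \<longlonglongrightarrow> 0"
    "\<And>u. u \<in> V \<Longrightarrow> iprod e u = \<phi> u"
proof -
  define J where "J u = norm_sq u - 2 * Re (\<phi> u)" for u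
  have J_bdd: "bdd_below (J ` V)"
  proof (rule bdd_belowI2)
    fix u assume "u \<in> V"
    have "Re (\<phi> u) \<le> B * sqrt (norm_sq u)"
      using bounded[OF \<open>u \<in> V\<close>] complex_Re_le_cmod[of "\<phi> u"] by linarith
    moreover have "0 \<le> (sqrt (norm_sq u) - B)\<^sup>2" by simp
    moreover have "(sqrt (norm_sq u))\<^sup>2 = norm_sq u" using norm_sq_nonneg by simp
    ultimately show "- (B\<^sup>2) \<le> J u"
      unfolding J_def power2_diff by (simp add: algebra_simps)
  qed
  define m where "m = Inf (J ` V)"
  have J_ge: "m \<le> J u" if "u \<in> V" for u
    unfolding m_def using that by (intro cInf_lower J_bdd) auto
  have "\<exists>u\<in>V. J u < m + 1 / 16 ^ n" for n :: nat
    using cInf_lessD[of "J ` V" "m + 1 / 16 ^ n"] V(2) by (auto simp: m_def)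
  \<comment> \<open>The rate \<open>1 / 16\<^sup>n\<close> is the one needed for almost everywhere convergence.\<close>
  then obtain w where w: "\<And>n. w n \<in> V" "\<And>n. J (w n) < m + 1 / 16 ^ n" by metis
  have w_L2: "w n \<in> L2" for n using w V by auto
  have "norm_sq (\<lambda>x. w k x - w n x) \<le> 4 / 16 ^ n" if "n \<le> k" for n k
  proof -
    let ?mid = "\<lambda>x. (1 / 2) * w k x + (1 / 2) * w n x"
    have "m \<le> J ?mid" by (intro J_ge V_linear w)
    moreover have "norm_sq (\<lambda>x. 1 * w k x + (-1) * w n x) = 2 * J (w k) + 2 * J (w n) - 4 * J ?mid"
      unfolding J_def norm_sq_linear[OF w_L2 w_L2] \<phi>_linear[OF w(1) w(1)]
      by (simp add: norm_divide power_divide)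
    moreover have "(1::real) / 16 ^ k \<le> 1 / 16 ^ n"
      using that by (intro divide_left_mono power_increasing) auto
    ultimately show ?thesis using w(2)[of k] w(2)[of n] by simp
  qed
  from fast_Cauchy_complete[OF w_L2 _ this] obtain e
    where e: "e \<in> L2" "\<And>n. norm_sq (\<lambda>x. w n x - e x) \<le> 4 / 16 ^ n" by auto
  have lim: "(\<lambda>n. norm_sq (\<lambda>x. w n x - e x)) \<longlonglongrightarrow> 0"
  proof (rule tendsto_sandwich[OF always_eventually always_eventually tendsto_const])
    show "\<forall>n. 0 \<le> norm_sq (\<lambda>x. w n x - e x)" "\<forall>n. norm_sq (\<lambda>x. w n x - e x) \<le> 4 * (1 / 16) ^ n"
      using e norm_sq_nonneg by (auto simp: power_divide)
    show "(\<lambda>n. 4 * (1 / 16) ^ n :: real) \<longlonglongrightarrow> 0"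
      by (intro tendsto_mult_right_zero LIMSEQ_realpow_zero) auto
  qed
  have Jlim: "(\<lambda>n. J (w n)) \<longlonglongrightarrow> m"
  proof (rule tendsto_sandwich[OF always_eventually always_eventually tendsto_const])
    show "\<forall>n. m \<le> J (w n)" "\<forall>n. J (w n) \<le> m + (1 / 16) ^ n"
      using w J_ge by (auto simp: power_divide less_imp_le)
    show "(\<lambda>n. m + (1 / 16) ^ n) \<longlonglongrightarrow> m"
      using tendsto_add[OF tendsto_const LIMSEQ_realpow_zero[of "1/16::real"], of m] by simp
  qed
  \<comment> \<open>The limit \<open>e\<close> may lie outside \<open>V\<close>, so \<open>J\<close> is varied at the minimizers and the limit is taken afterwards.\<close>
  have Re_eq: "Re (iprod e u) = Re (\<phi> u)" if u: "u \<in> V" for u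
  proof -
    let ?b = "Re (iprod e u) - Re (\<phi> u)"
    have uL2: "u \<in> L2" using u V by auto
    have iprodl: "(\<lambda>n. Re (iprod (w n) u)) \<longlonglongrightarrow> Re (iprod e u)"
      using tendsto_Re[OF iprod_tendsto[OF w_L2 e(1) uL2 lim]]
      by (simp add: iprod_cnj[of _ u])
    have *: "0 \<le> t\<^sup>2 * norm_sq u + 2 * t * ?b" for t :: real
    proof -
      have "m \<le> J (w n) + (t\<^sup>2 * norm_sq u + 2 * t * (Re (iprod (w n) u) - Re (\<phi> u)))" for n
      proof -
        have "m \<le> J (\<lambda>x. 1 * w n x + of_real t * u x)" by (intro J_ge V_linear w u)
        also have "\<dots> = J (w n) + (t\<^sup>2 * norm_sq u + 2 * t * (Re (iprod (w n) u) - Re (\<phi> u)))"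
          unfolding J_def norm_sq_linear[OF w_L2 uL2] \<phi>_linear[OF w(1) u] by (simp add: algebra_simps)
        finally show ?thesis .
      qed
      moreover have "(\<lambda>n. J (w n) + (t\<^sup>2 * norm_sq u + 2 * t * (Re (iprod (w n) u) - Re (\<phi> u))))
          \<longlonglongrightarrow> m + (t\<^sup>2 * norm_sq u + 2 * t * ?b)"
        by (intro tendsto_intros Jlim iprodl)
      ultimately have "m \<le> m + (t\<^sup>2 * norm_sq u + 2 * t * ?b)"
        using LIMSEQ_le_const by blast
      then show ?thesis by simp
    qed
    from linear_term_zero[OF norm_sq_nonneg this] show ?thesis by simp
  qed
  have "iprod e u = \<phi> u" if u: "u \<in> V" for u
  proof (rule complex_eqI)
    \<comment> \<open>The imaginary part of \<open>\<phi> u\<close> is minus the real part of \<open>\<phi> (\<i> u)\<close>.\<close>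
    have "Re (iprod e (\<lambda>x. \<i> * u x + 0 * u x)) = Re (\<phi> (\<lambda>x. \<i> * u x + 0 * u x))"
      by (intro Re_eq V_linear u)
    then show "Im (iprod e u) = Im (\<phi> u)"
      using iprod_linear[of e u u \<i> 0] \<phi>_linear[OF u u, of \<i> 0] e(1) u V by auto
  qed (rule Re_eq[OF u])
  with that e(1) w(1) lim show ?thesis by blast
qed

end

section \<open>Square-integrable sections\<close>

context kostant_souriau
begin

text \<open>The functions on the orbit that arise from measurable sections. The factor that relates such a
  function to the lift of its section has modulus one and depends on the group element only, so it cancels in products
  and passes through pointwise limits. This is why the completeness theorem applies to sections.\<close>

definition measurable_coeffs :: "(('e \<Rightarrow> real) \<Rightarrow> complex) set" where
  "measurable_coeffs = {u. borel_fun Q (lift Q (untriv u))}"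

lemma mem_measurable_coeffs: "u \<in> measurable_coeffs \<longleftrightarrow> borel_fun Q (lift Q (untriv u))"
  by (simp add: measurable_coeffs_def)

lemma transition_nonzero: "g \<in> carrier Q \<Longrightarrow> transition g (rep (pt g)) \<noteq> 0"
  using transition_norm[of g "rep (pt g)"] rep[of "pt g"] by auto

lemma untriv_product:
  assumes "g \<in> carrier Q"
  shows "cnj (lift Q (untriv u) g) * lift Q (untriv v) g = cnj (u (pt g)) * v (pt g)"
  using lherm_lift[OF untriv_section untriv_section assms, of u v]
    lherm_triv[OF untriv_section untriv_section, of "pt g" u v] assms by simp

sublocale square_integrable_class "vol Q" measurable_coeffs
proof
  fix u v :: "('e \<Rightarrow> real) \<Rightarrow> complex" and a b :: complex
  assume "u \<in> measurable_coeffs" "v \<in> measurable_coeffs"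
  then have uv: "borel_fun Q (lift Q (untriv u))" "borel_fun Q (lift Q (untriv v))"
    by (simp_all add: mem_measurable_coeffs)
  then have "borel_fun Q (\<lambda>g. a * lift Q (untriv u) g + b * lift Q (untriv v) g)"
    unfolding borel_fun_def by (intro borel_measurable_add borel_measurable_times) auto
  then show "(\<lambda>x. a * u x + b * v x) \<in> measurable_coeffs"
    unfolding mem_measurable_coeffs
    by (subst borel_fun_cong) (auto simp: lift_untriv algebra_simps)
  have "borel_fun Q (\<lambda>g. cnj (lift Q (untriv u) g) * lift Q (untriv v) g)"
    using uv unfolding borel_fun_def
    by (intro borel_measurable_times measurable_compose[OF _ borel_measurable_continuous_onI[of cnj]])
      (auto intro: continuous_intros)
  then have "borel_fun Q (\<lambda>g. cnj (u (pt g)) * v (pt g))"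
    by (subst borel_fun_cong[OF untriv_product[symmetric]])
  then show "(\<lambda>x. cnj (u x) * v x) \<in> borel_measurable (vol Q)"
    by (rule measurable_on_orbit)
next
  fix w :: "nat \<Rightarrow> ('e \<Rightarrow> real) \<Rightarrow> complex"
  assume w: "\<And>n. w n \<in> measurable_coeffs"
  let ?f = "\<lambda>n. lift Q (untriv (w n))"
  have f: "?f n \<in> borel_measurable borelG" for n
    using w by (simp add: mem_measurable_coeffs borel_fun_def)
  have "{g \<in> space borelG. convergent (\<lambda>n. ?f n g)} \<in> sets borelG"
    unfolding Cauchy_convergent_iff[symmetric] using f by (rule sets_Collect_Cauchy)
  then have "borel_fun Q (\<lambda>g. if convergent (\<lambda>n. ?f n g) then lim (\<lambda>n. ?f n g) else 0)"
    unfolding borel_fun_def using f by (intro measurable_If borel_measurable_lim_metric) auto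
  moreover have "lift Q (untriv (\<lambda>x. if convergent (\<lambda>n. w n x) then lim (\<lambda>n. w n x) else 0)) g
      = (if convergent (\<lambda>n. ?f n g) then lim (\<lambda>n. ?f n g) else 0)" if g: "g \<in> carrier Q" for g
  proof -
    note nz = transition_nonzero[OF g]
    have "convergent (\<lambda>n. ?f n g) \<longleftrightarrow> convergent (\<lambda>n. w n (pt g))"
      using nz by (simp add: lift_untriv[OF g] convergent_mult_const_iff)
    moreover have "lim (\<lambda>n. ?f n g) = transition g (rep (pt g)) * lim (\<lambda>n. w n (pt g))"
      if "convergent (\<lambda>n. w n (pt g))"
      using that unfolding lift_untriv[OF g]
      by (intro limI tendsto_mult_left) (simp add: convergent_LIMSEQ_iff)
    ultimately show ?thesis by (simp add: lift_untriv[OF g])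
  qed
  ultimately show "(\<lambda>x. if convergent (\<lambda>n. w n x) then lim (\<lambda>n. w n x) else 0) \<in> measurable_coeffs"
    unfolding mem_measurable_coeffs by (subst borel_fun_cong) auto
qed

lemma norm_sq_cong: "(\<And>x. x \<in> orbit Q \<Longrightarrow> u x = u' x) \<Longrightarrow> norm_sq u = norm_sq u'"
  unfolding norm_sq_def by (rule Bochner_Integration.integral_cong) (auto simp: space_vol)

lemma iprod_cong:
  "(\<And>x. x \<in> orbit Q \<Longrightarrow> u x = u' x) \<Longrightarrow> (\<And>x. x \<in> orbit Q \<Longrightarrow> v x = v' x) \<Longrightarrow> iprod u v = iprod u' v'"
  unfolding iprod_def by (rule Bochner_Integration.integral_cong) (auto simp: space_vol)

lemma sinner_triv:
  "s \<in> lsections Q \<Longrightarrow> s' \<in> lsections Q \<Longrightarrow> sinner Q s s' = iprod (triv s) (triv s')"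
  unfolding sinner_def iprod_def
  by (rule Bochner_Integration.integral_cong) (auto simp: space_vol lherm_triv)

lemma snorm_triv: "s \<in> lsections Q \<Longrightarrow> snorm Q s = sqrt (norm_sq (triv s))"
  by (simp add: snorm_def sinner_triv iprod_self)

lemma L2_sections_iff: "s \<in> L2_sections Q \<longleftrightarrow> s \<in> lsections Q \<and> triv s \<in> L2"
proof (cases "s \<in> lsections Q")
  case s: True
  have "integrable (vol Q) (\<lambda>x. lherm (s x) (s x)) \<longleftrightarrow>
      integrable (vol Q) (\<lambda>x. complex_of_real ((cmod (triv s x))\<^sup>2))"
    by (rule Bochner_Integration.integrable_cong)
      (auto simp: space_vol lherm_triv[OF s s] complex_norm_square mult.commute simp del: of_real_power)
  then show ?thesis
    using s by (simp add: L2_sections_def L2_def mem_measurable_coeffs complex_of_real_integrable_eq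
        del: of_real_power)
qed (simp add: L2_sections_def)

lemma L2_sectionsD: "s \<in> L2_sections Q \<Longrightarrow> s \<in> lsections Q" "s \<in> L2_sections Q \<Longrightarrow> triv s \<in> L2"
  by (simp_all add: L2_sections_iff)

lemma L2_cong:
  assumes "\<And>x. x \<in> orbit Q \<Longrightarrow> u x = u' x"
  shows "u \<in> L2 \<longleftrightarrow> u' \<in> L2"
proof -
  have "untriv u = untriv u'" by (rule untriv_cong) (rule assms)
  moreover have "integrable (vol Q) (\<lambda>x. (cmod (u x))\<^sup>2) \<longleftrightarrow> integrable (vol Q) (\<lambda>x. (cmod (u' x))\<^sup>2)"
    by (rule Bochner_Integration.integrable_cong) (auto simp: space_vol assms)
  ultimately show ?thesis by (simp add: L2_def mem_measurable_coeffs)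
qed

lemma untriv_L2: "untriv u \<in> L2_sections Q \<longleftrightarrow> u \<in> L2"
  using L2_cong[of "triv (untriv u)" u] by (simp add: L2_sections_iff)

lemma snorm_sdiff:
  assumes "s \<in> lsections Q" "s' \<in> lsections Q"
  shows "snorm Q (sdiff Q s s') = sqrt (norm_sq (\<lambda>x. triv s x - triv s' x))"
  using assms norm_sq_cong[OF triv_untriv] by (simp add: sdiff_untriv snorm_triv)

lemma L2_conv_iff:
  assumes "\<And>n. \<sigma> n \<in> lsections Q" "\<psi> \<in> lsections Q"
  shows "L2_conv Q \<sigma> \<psi> \<longleftrightarrow> (\<lambda>n. norm_sq (\<lambda>x. triv (\<sigma> n) x - triv \<psi> x)) \<longlonglongrightarrow> 0"
proof -
  let ?a = "\<lambda>n. norm_sq (\<lambda>x. triv (\<sigma> n) x - triv \<psi> x)"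
  have "(\<lambda>n. sqrt (?a n)) \<longlonglongrightarrow> 0 \<longleftrightarrow> ?a \<longlonglongrightarrow> 0"
  proof
    assume "(\<lambda>n. sqrt (?a n)) \<longlonglongrightarrow> 0"
    from tendsto_power[OF this, of 2] show "?a \<longlonglongrightarrow> 0" by (simp add: norm_sq_nonneg)
  next
    assume "?a \<longlonglongrightarrow> 0"
    from tendsto_real_sqrt[OF this] show "(\<lambda>n. sqrt (?a n)) \<longlonglongrightarrow> 0" by simp
  qed
  then show ?thesis by (simp add: L2_conv_def snorm_sdiff assms)
qed

lemma lift_combination:
  assumes "s \<in> lsections Q" "s' \<in> lsections Q" "g \<in> carrier Q"
  shows "lift Q (untriv (\<lambda>x. a * triv s x + b * triv s' x)) g = a * lift Q s g + b * lift Q s' g"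
  using assms by (simp add: lift_untriv lift_triv algebra_simps)

lemma lift_sscale:
  assumes "s \<in> lsections Q" "g \<in> carrier Q"
  shows "lift Q (sscale Q z s) g = z * lift Q s g"
  using assms by (simp add: sscale_untriv lift_untriv lift_triv algebra_simps)

lemma lift_sdiff:
  assumes "s \<in> lsections Q" "s' \<in> lsections Q" "g \<in> carrier Q"
  shows "lift Q (sdiff Q s s') g = lift Q s g - lift Q s' g"
  using assms by (simp add: sdiff_untriv lift_untriv lift_triv algebra_simps)

lemma sscale_section [simp]: "s \<in> lsections Q \<Longrightarrow> sscale Q z s \<in> lsections Q"
  by (simp add: sscale_untriv)

lemma sdiff_section [simp]: "s \<in> lsections Q \<Longrightarrow> s' \<in> lsections Q \<Longrightarrow> sdiff Q s s' \<in> lsections Q"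
  by (simp add: sdiff_untriv)

lemma triv_sscale: "s \<in> lsections Q \<Longrightarrow> x \<in> orbit Q \<Longrightarrow> triv (sscale Q z s) x = z * triv s x"
  by (simp add: sscale_untriv)

lemma sscale_L2: "s \<in> L2_sections Q \<Longrightarrow> sscale Q z s \<in> L2_sections Q"
  using L2_linear[of "triv s" "triv s" z 0] L2_sectionsD[of s]
  by (simp add: sscale_untriv untriv_L2)

lemma sinner_sscale_left:
  assumes "s \<in> L2_sections Q" "s' \<in> L2_sections Q"
  shows "sinner Q (sscale Q z s) s' = cnj z * sinner Q s s'"
proof -
  note S = L2_sectionsD[OF assms(1)] L2_sectionsD[OF assms(2)]
  have "sinner Q (sscale Q z s) s' = iprod (\<lambda>x. z * triv s x + 0 * triv s x) (triv s')"
    using S by (simp add: sinner_triv) (rule iprod_cong; simp add: triv_sscale)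
  then show ?thesis
    using S iprod_linear_left[of "triv s'" "triv s" "triv s" z 0] by (simp add: sinner_triv)
qed

lemma sact_sscale:
  assumes "s \<in> lsections Q" "g \<in> carrier Q"
  shows "sact Q g (sscale Q z s) = sscale Q z (sact Q g s)"
  using assms by (intro lsections_eqI) (simp_all add: lift_sact lift_sscale)

lemma sact_sdiff:
  assumes "s \<in> lsections Q" "s' \<in> lsections Q" "g \<in> carrier Q"
  shows "sdiff Q (sact Q g s) (sact Q g s') = sact Q g (sdiff Q s s')"
  using assms by (intro lsections_eqI) (simp_all add: lift_sact lift_sdiff)

lemma sact_one:
  assumes "s \<in> lsections Q"
  shows "sact Q \<one> s = s"
  using assms by (intro lsections_eqI) (simp_all add: lift_sact)

lemma sdiff_L2:
  assumes "s \<in> L2_sections Q" "s' \<in> L2_sections Q"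
  shows "sdiff Q s s' \<in> L2_sections Q"
  using L2_diff L2_sectionsD assms by (simp add: sdiff_untriv untriv_L2)

section \<open>Unitarity of the group action\<close>

lemma lherm_sact:
  assumes "s \<in> lsections Q" "s' \<in> lsections Q" "g \<in> carrier Q" "y \<in> orbit Q"
  shows "lherm (sact Q g s y) (sact Q g s' y) = lherm (s (coad Q (inv g) y)) (s' (coad Q (inv g) y))"
proof -
  obtain a where "a \<in> carrier Q" "y = pt a" using assms(4) by (auto elim: orbitE)
  then show ?thesis
    using assms lherm_lift[OF sact_section[OF assms(1,3)] sact_section[OF assms(2,3)], of a]
      lherm_lift[OF assms(1,2), of "inv g \<otimes> a"]
    by (simp add: lift_sact coad_mult)
qed

lemma lherm_measurable:
  assumes "s \<in> L2_sections Q" "s' \<in> L2_sections Q"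
  shows "(\<lambda>x. lherm (s x) (s' x)) \<in> borel_measurable (vol Q)"
  using product_measurable[OF L2_M[OF L2_sectionsD(2)[OF assms(1)]] L2_M[OF L2_sectionsD(2)[OF assms(2)]]]
  by (subst measurable_cong[where g = "\<lambda>x. cnj (triv s x) * triv s' x"])
    (simp_all add: space_vol lherm_triv L2_sectionsD assms)

text \<open>The action moves base points by a measure-preserving map and leaves fibre coordinates unchanged.\<close>

lemma sinner_sact:
  assumes "s \<in> L2_sections Q" "s' \<in> L2_sections Q" "g \<in> carrier Q"
  shows "sinner Q (sact Q g s) (sact Q g s') = sinner Q s s'"
proof -
  let ?h = "\<lambda>x. lherm (s x) (s' x)"
  have "sinner Q (sact Q g s) (sact Q g s') = (\<integral>y. ?h (coad Q (inv g) y) \<partial>vol Q)"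
    unfolding sinner_def using assms
    by (intro Bochner_Integration.integral_cong) (auto simp: space_vol lherm_sact L2_sectionsD)
  also have "\<dots> = (\<integral>x. ?h x \<partial>distr (vol Q) (vol Q) (coad Q (inv g)))"
    using assms by (intro integral_distr[symmetric] coad_measurable lherm_measurable) auto
  also have "\<dots> = sinner Q s s'"
    using assms by (simp add: distr_coad sinner_def)
  finally show ?thesis .
qed

lemma borel_lift_sact:
  assumes "s \<in> lsections Q" "borel_fun Q (lift Q s)" "g \<in> carrier Q"
  shows "borel_fun Q (lift Q (sact Q g s))"
  using borel_fun_left_translate[OF assms(2) inv_closed[OF assms(3)]]
  by (subst borel_fun_cong) (auto simp: lift_sact assms)

lemma sact_L2:
  assumes s: "s \<in> L2_sections Q" and g: "g \<in> carrier Q"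
  shows "sact Q g s \<in> L2_sections Q"
proof -
  let ?h = "\<lambda>x. lherm (s x) (s x)"
  note S = L2_sectionsD(1)[OF s]
  have "integrable (distr (vol Q) (vol Q) (coad Q (inv g))) ?h"
    using s g by (simp add: distr_coad L2_sections_def)
  then have "integrable (vol Q) (\<lambda>y. ?h (coad Q (inv g) y))"
    using g by (subst (asm) integrable_distr_eq) (auto intro: coad_measurable lherm_measurable s)
  then have "integrable (vol Q) (\<lambda>y. lherm (sact Q g s y) (sact Q g s y))"
    by (subst Bochner_Integration.integrable_cong) (auto simp: space_vol lherm_sact S g)
  then show ?thesis
    using s g S by (simp add: L2_sections_def borel_lift_sact)
qed

lemma snorm_sact: "s \<in> L2_sections Q \<Longrightarrow> g \<in> carrier Q \<Longrightarrow> snorm Q (sact Q g s) = snorm Q s"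
  by (simp add: snorm_def sinner_sact)

section \<open>Sections modulo null sets\<close>

lemma sec_eq_iff:
  assumes "\<phi> \<in> lsections Q" "\<psi> \<in> lsections Q"
  shows "sec_eq Q \<phi> \<psi> \<longleftrightarrow> (AE x in vol Q. triv \<phi> x = triv \<psi> x)"
  unfolding sec_eq_def
  by (rule AE_cong) (simp add: space_vol section_triv[OF assms(1)] section_triv[OF assms(2)] lcls_eq_iff rep)

lemma sec_eq_sscale_iff:
  assumes "\<phi> \<in> lsections Q" "\<psi> \<in> lsections Q"
  shows "sec_eq Q \<phi> (sscale Q c \<psi>) \<longleftrightarrow> (AE x in vol Q. triv \<phi> x = c * triv \<psi> x)"
proof -
  have "sec_eq Q \<phi> (sscale Q c \<psi>) \<longleftrightarrow> (AE x in vol Q. triv \<phi> x = triv (sscale Q c \<psi>) x)"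
    using assms by (simp add: sec_eq_iff)
  also have "\<dots> \<longleftrightarrow> (AE x in vol Q. triv \<phi> x = c * triv \<psi> x)"
    by (rule AE_cong) (simp add: space_vol triv_sscale assms)
  finally show ?thesis .
qed

lemma sec_eq_sscale_sym:
  assumes "\<phi> \<in> lsections Q" "\<psi> \<in> lsections Q" "c \<noteq> 0" "sec_eq Q \<phi> (sscale Q c \<psi>)"
  shows "sec_eq Q \<psi> (sscale Q (1 / c) \<phi>)"
  using assms by (auto simp: sec_eq_sscale_iff)

lemma sec_eq_sscale_trans:
  assumes "\<phi> \<in> lsections Q" "\<psi> \<in> lsections Q" "\<rho> \<in> lsections Q"
    and "sec_eq Q \<phi> (sscale Q c \<psi>)" "sec_eq Q \<psi> (sscale Q d \<rho>)"
  shows "sec_eq Q \<phi> (sscale Q (c * d) \<rho>)"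
  using assms by (auto simp: sec_eq_sscale_iff elim: AE_mp[rotated])

lemma sec_eq_sact:
  assumes "sec_eq Q \<phi> \<psi>" "g \<in> carrier Q"
  shows "sec_eq Q (sact Q g \<phi>) (sact Q g \<psi>)"
proof -
  have "AE x in distr (vol Q) (vol Q) (coad Q (inv g)). \<phi> x = \<psi> x"
    unfolding distr_coad[OF inv_closed[OF assms(2)]] using assms by (simp add: sec_eq_def)
  then have "AE y in vol Q. \<phi> (coad Q (inv g) y) = \<psi> (coad Q (inv g) y)"
    using coad_measurable[of "inv g"] assms by (auto dest: AE_distrD)
  then show ?thesis
    unfolding sec_eq_def by (rule AE_mp) (auto simp: sact_def)
qed

end

section \<open>The quantization module\<close>

locale quantization_module = kostant_souriau Q
  for Q :: "('g, 'e::euclidean_space) quantum_data" (structure) +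
  fixes \<Gamma> :: "('g, 'e) sec set"
  assumes module: "prehilbert_module Q \<Gamma>"
    and ev_bounded: "q \<in> lbundle0 Q \<Longrightarrow> ev_bounded Q \<Gamma> q"
    and nontrivial: "\<exists>s\<in>\<Gamma>. snorm Q s \<noteq> 0"
begin

lemma module_L2: "s \<in> \<Gamma> \<Longrightarrow> s \<in> L2_sections Q"
  and module_smooth: "s \<in> \<Gamma> \<Longrightarrow> smooth_fun Q (lift Q s)"
  using module by (auto simp: prehilbert_module_def smooth_L2_sections_def)

lemma module_section: "s \<in> \<Gamma> \<Longrightarrow> s \<in> lsections Q"
  using module_L2 L2_sectionsD by blast

text \<open>Both kinds of module are cut out of the square-integrable sections by conditions on the lift, so one
  criterion serves smooth and polarized sections alike. In place of naming the polarization, it asks \<open>t\<close> to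
  inherit every polarization condition that the whole module satisfies.\<close>

lemma module_closed:
  assumes t: "t \<in> L2_sections Q" "smooth_fun Q (lift Q t)"
    and pol: "\<And>p. (\<And>s. s \<in> \<Gamma> \<Longrightarrow> polarized Q p s) \<Longrightarrow> polarized Q p t"
  shows "t \<in> \<Gamma>"
  using module unfolding prehilbert_module_def
proof (elim disjE exE conjE)
  assume "\<Gamma> = smooth_L2_sections Q"
  then show ?thesis using t by (simp add: smooth_L2_sections_def)
next
  fix p assume \<Gamma>: "\<Gamma> = {s \<in> smooth_L2_sections Q. polarized Q p s}"
  have "polarized Q p t" by (rule pol) (simp add: \<Gamma>)
  then show ?thesis using t by (simp add: \<Gamma> smooth_L2_sections_def)
qed

lemma module_linear:
  assumes s: "s \<in> \<Gamma>" and s': "s' \<in> \<Gamma>"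
  shows "untriv (\<lambda>x. a * triv s x + b * triv s' x) \<in> \<Gamma>" (is "?t \<in> \<Gamma>")
proof (rule module_closed)
  note S = module_section[OF s] module_section[OF s']
  note lift_t = lift_combination[OF S, of _ a b]
  show "?t \<in> L2_sections Q"
    unfolding untriv_L2 by (intro L2_linear L2_sectionsD module_L2 s s')
  show "smooth_fun Q (lift Q ?t)"
    using smooth_fun_linear[OF module_smooth[OF s] module_smooth[OF s'], of a b]
    by (subst smooth_fun_cong[OF lift_t])
  fix p assume "\<And>s. s \<in> \<Gamma> \<Longrightarrow> polarized Q p s"
  then have pol: "polarized Q p s" "polarized Q p s'" using s s' by auto
  show "polarized Q p ?t"
    unfolding polarized_def
  proof (intro ballI, clarify)
    fix X Y g assume p: "(X, Y) \<in> p" and g: "g \<in> carrier Q"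
    let ?k = "\<i> / complex_of_real (hbar Q) * (complex_of_real (covec Q X) + \<i> * complex_of_real (covec Q Y))"
    have *: "left_deriv Q Z (lift Q ?t) g = a * left_deriv Q Z (lift Q s) g + b * left_deriv Q Z (lift Q s') g" for Z
      using left_deriv_linear[OF module_smooth[OF s] module_smooth[OF s'] g, where X = Z and a = a and b = b]
        left_deriv_cong[OF lift_t g, where X = Z] by simp
    have "left_deriv Q X (lift Q s) g + \<i> * left_deriv Q Y (lift Q s) g + ?k * lift Q s g = 0"
      "left_deriv Q X (lift Q s') g + \<i> * left_deriv Q Y (lift Q s') g + ?k * lift Q s' g = 0"
      using pol p g unfolding polarized_def by blast+
    moreover have "left_deriv Q X (lift Q ?t) g + \<i> * left_deriv Q Y (lift Q ?t) g + ?k * lift Q ?t g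
      = a * (left_deriv Q X (lift Q s) g + \<i> * left_deriv Q Y (lift Q s) g + ?k * lift Q s g)
      + b * (left_deriv Q X (lift Q s') g + \<i> * left_deriv Q Y (lift Q s') g + ?k * lift Q s' g)"
      unfolding * lift_t[OF g] by (simp only: algebra_simps)
    ultimately show "left_deriv Q X (lift Q ?t) g + \<i> * left_deriv Q Y (lift Q ?t) g + ?k * lift Q ?t g = 0"
      by simp
  qed
qed

text \<open>On lifts \<open>g\<close> acts by left translation, which commutes with the left-invariant vector fields that occur in
  the polarization condition.\<close>

lemma module_sact:
  assumes s: "s \<in> \<Gamma>" and g: "g \<in> carrier Q"
  shows "sact Q g s \<in> \<Gamma>"
proof (rule module_closed)
  note S = module_section[OF s]
  show "sact Q g s \<in> L2_sections Q" by (intro sact_L2 module_L2 s g)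
  show "smooth_fun Q (lift Q (sact Q g s))"
    using smooth_fun_left_translate[OF module_smooth[OF s] inv_closed[OF g]]
    by (subst smooth_fun_cong[OF lift_sact[OF S g]])
  fix p assume "\<And>s. s \<in> \<Gamma> \<Longrightarrow> polarized Q p s"
  then have pol: "polarized Q p s" using s by auto
  show "polarized Q p (sact Q g s)"
    unfolding polarized_def
  proof (intro ballI, clarify)
    fix X Y a assume p: "(X, Y) \<in> p" and a: "a \<in> carrier Q"
    have *: "left_deriv Q Z (lift Q (sact Q g s)) a = left_deriv Q Z (lift Q s) (inv g \<otimes> a)" for Z
      using left_deriv_left_translate[OF inv_closed[OF g] a, where X = Z and f = "lift Q s"]
        left_deriv_cong[OF lift_sact[OF S g] a, where X = Z] by simp
    show "left_deriv Q X (lift Q (sact Q g s)) a + \<i> * left_deriv Q Y (lift Q (sact Q g s)) a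
       + \<i> / complex_of_real (hbar Q) * (complex_of_real (covec Q X) + \<i> * complex_of_real (covec Q Y))
         * lift Q (sact Q g s) a = 0"
      unfolding * lift_sact[OF S g a] using pol p a g unfolding polarized_def by blast
  qed
qed

section \<open>The Hilbert space\<close>

lemma hilb_L2: "\<psi> \<in> hilb Q \<Gamma> \<Longrightarrow> \<psi> \<in> L2_sections Q"
  by (simp add: hilb_def)

lemma hilb_section: "\<psi> \<in> hilb Q \<Gamma> \<Longrightarrow> \<psi> \<in> lsections Q"
  using hilb_L2 L2_sectionsD by blast

lemma L2_conv_const: "s \<in> lsections Q \<Longrightarrow> L2_conv Q (\<lambda>_. s) s"
  by (simp add: L2_conv_def snorm_sdiff norm_sq_def)

lemma module_hilb: "s \<in> \<Gamma> \<Longrightarrow> s \<in> hilb Q \<Gamma>"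
  unfolding hilb_def using module_L2 L2_conv_const[OF module_section]
  by (auto intro!: exI[of _ "\<lambda>_. s"])

lemma hilb_sact:
  assumes "\<psi> \<in> hilb Q \<Gamma>" "g \<in> carrier Q"
  shows "sact Q g \<psi> \<in> hilb Q \<Gamma>"
proof -
  obtain \<sigma> where \<sigma>: "range \<sigma> \<subseteq> \<Gamma>" "L2_conv Q \<sigma> \<psi>" using assms by (auto simp: hilb_def)
  have \<sigma>_in: "\<sigma> n \<in> \<Gamma>" for n using \<sigma>(1) by auto
  have "snorm Q (sdiff Q (sact Q g (\<sigma> n)) (sact Q g \<psi>)) = snorm Q (sdiff Q (\<sigma> n) \<psi>)" for n
    unfolding sact_sdiff[OF module_section[OF \<sigma>_in] hilb_section[OF assms(1)] assms(2)]
    by (intro snorm_sact sdiff_L2 module_L2 \<sigma>_in hilb_L2 assms)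
  with \<sigma>(2) have "L2_conv Q (\<lambda>n. sact Q g (\<sigma> n)) (sact Q g \<psi>)" by (simp add: L2_conv_def)
  moreover have "range (\<lambda>n. sact Q g (\<sigma> n)) \<subseteq> \<Gamma>" using \<sigma>(1) assms(2) by (auto intro: module_sact)
  ultimately show ?thesis
    using sact_L2[OF hilb_L2[OF assms(1)] assms(2)] unfolding hilb_def by blast
qed

lemma hilb_sscale:
  assumes "\<psi> \<in> hilb Q \<Gamma>"
  shows "sscale Q z \<psi> \<in> hilb Q \<Gamma>"
proof -
  obtain \<sigma> where \<sigma>: "range \<sigma> \<subseteq> \<Gamma>" "L2_conv Q \<sigma> \<psi>" using assms by (auto simp: hilb_def)
  note S = hilb_section[OF assms]
  have \<sigma>S: "\<sigma> n \<in> lsections Q" for n using \<sigma>(1) module_section by auto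
  have "norm_sq (\<lambda>x. triv (sscale Q z (\<sigma> n)) x - triv (sscale Q z \<psi>) x)
      = (cmod z)\<^sup>2 * norm_sq (\<lambda>x. triv (\<sigma> n) x - triv \<psi> x)" for n
    unfolding norm_sq_scale[symmetric] by (rule norm_sq_cong) (simp add: triv_sscale \<sigma>S S algebra_simps)
  then have "L2_conv Q (\<lambda>n. sscale Q z (\<sigma> n)) (sscale Q z \<psi>)"
    using \<sigma>(2) by (simp add: L2_conv_iff \<sigma>S S tendsto_mult_right_zero)
  moreover have "sscale Q z s \<in> \<Gamma>" if "s \<in> \<Gamma>" for s
    using module_linear[OF that that, of z 0] by (simp add: sscale_untriv module_section that)
  then have "range (\<lambda>n. sscale Q z (\<sigma> n)) \<subseteq> \<Gamma>" using \<sigma>(1) by auto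
  ultimately show ?thesis
    using sscale_L2[OF hilb_L2[OF assms]] unfolding hilb_def by blast
qed

lemma sinner_tendsto:
  assumes "e \<in> L2_sections Q" "\<psi> \<in> L2_sections Q" "range \<sigma> \<subseteq> \<Gamma>" "L2_conv Q \<sigma> \<psi>"
  shows "(\<lambda>n. sinner Q e (\<sigma> n)) \<longlonglongrightarrow> sinner Q e \<psi>"
proof -
  have \<sigma>: "\<sigma> n \<in> L2_sections Q" for n using assms(3) module_L2 by auto
  have "(\<lambda>n. norm_sq (\<lambda>x. triv (\<sigma> n) x - triv \<psi> x)) \<longlonglongrightarrow> 0"
    using assms(4) L2_sectionsD(1) \<sigma> assms(2) by (simp add: L2_conv_iff)
  then have "(\<lambda>n. iprod (triv e) (triv (\<sigma> n))) \<longlonglongrightarrow> iprod (triv e) (triv \<psi>)"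
    using \<sigma> assms(1,2) by (intro iprod_tendsto L2_sectionsD)
  then show ?thesis
    by (simp add: sinner_triv L2_sectionsD \<sigma> assms(1,2))
qed

section \<open>Coherent vectors\<close>

text \<open>The Riesz property tested on the dense module only. It suffices, by continuity, to determine a vector up
  to null sets, and unlike the property on the whole Hilbert space it can be checked by evaluating sections.\<close>

definition represents :: "'g line_pt \<Rightarrow> ('g, 'e) sec \<Rightarrow> bool" where
  "represents q e \<longleftrightarrow> e \<in> hilb Q \<Gamma> \<and> (\<forall>s\<in>\<Gamma>. sinner Q e s = ev Q q s)"

lemma representing_vector_exists:
  assumes q: "q \<in> lbundle0 Q"
  shows "\<exists>e. represents q e"
proof -
  obtain g v where g: "g \<in> carrier Q" and v: "v \<noteq> 0" and q_eq: "q = lcls Q g v"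
    using q by (rule lbundle0E)
  obtain B where B: "\<And>s. s \<in> \<Gamma> \<Longrightarrow> cmod (ev Q q s) \<le> B * snorm Q s"
    using ev_bounded[OF q] by (auto simp: ev_bounded_def)
  define V where "V = {u. untriv u \<in> \<Gamma>}"
  define \<phi> where "\<phi> u = ev Q q (untriv u)" for u
  have comb: "untriv (\<lambda>x. a * triv (untriv u) x + b * triv (untriv u') x) = untriv (\<lambda>x. a * u x + b * u' x)"
    for a b u u' by (rule untriv_cong) simp
  obtain e w where e: "e \<in> L2" and w: "\<And>n. w n \<in> V"
    and lim: "(\<lambda>n. norm_sq (\<lambda>x. w n x - e x)) \<longlonglongrightarrow> 0" and rep: "\<And>u. u \<in> V \<Longrightarrow> iprod e u = \<phi> u"
  proof (rule Riesz_representation[of V \<phi> B])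
    show "V \<subseteq> L2" using module_L2 untriv_L2 by (auto simp: V_def)
    obtain s where "s \<in> \<Gamma>" using nontrivial by auto
    then have "triv s \<in> V" by (simp add: V_def module_section)
    then show "V \<noteq> {}" by auto
    fix u u' a b assume "u \<in> V" "u' \<in> V"
    then show "(\<lambda>x. a * u x + b * u' x) \<in> V"
      using module_linear[of "untriv u" "untriv u'" a b] by (simp add: V_def comb)
    show "\<phi> (\<lambda>x. a * u x + b * u' x) = a * \<phi> u + b * \<phi> u'"
      using g v by (simp add: \<phi>_def q_eq ev_lcls lift_untriv add_divide_distrib algebra_simps)
  next
    fix u assume "u \<in> V"
    then show "cmod (\<phi> u) \<le> B * sqrt (norm_sq u)"
      using B[of "untriv u"] norm_sq_cong[of "triv (untriv u)" u] by (simp add: \<phi>_def V_def snorm_triv)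
  qed (rule that)
  have "represents q (untriv e)"
    unfolding represents_def
  proof (intro conjI ballI)
    have "norm_sq (\<lambda>x. triv (untriv (w n)) x - triv (untriv e) x) = norm_sq (\<lambda>x. w n x - e x)" for n
      by (rule norm_sq_cong) simp
    then have "L2_conv Q (\<lambda>n. untriv (w n)) (untriv e)"
      using lim by (simp add: L2_conv_iff)
    then show "untriv e \<in> hilb Q \<Gamma>"
      using w e by (auto simp: hilb_def untriv_L2 V_def intro!: exI[of _ "\<lambda>n. untriv (w n)"])
    fix s assume s: "s \<in> \<Gamma>"
    then have "sinner Q (untriv e) s = iprod e (triv s)"
      by (simp add: sinner_triv module_section) (rule iprod_cong; simp)
    also have "\<dots> = ev Q q s"
      using rep[of "triv s"] s by (simp add: V_def \<phi>_def module_section)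
    finally show "sinner Q (untriv e) s = ev Q q s" .
  qed
  then show ?thesis by blast
qed

lemma represents_hilb: "represents q e \<Longrightarrow> e \<in> hilb Q \<Gamma>"
  and represents_ev: "represents q e \<Longrightarrow> s \<in> \<Gamma> \<Longrightarrow> sinner Q e s = ev Q q s"
  by (simp_all add: represents_def)

lemma ev_tendsto:
  assumes "represents q e" "\<psi> \<in> hilb Q \<Gamma>" "range \<sigma> \<subseteq> \<Gamma>" "L2_conv Q \<sigma> \<psi>"
  shows "(\<lambda>n. ev Q q (\<sigma> n)) \<longlonglongrightarrow> sinner Q e \<psi>"
proof -
  have "sinner Q e (\<sigma> n) = ev Q q (\<sigma> n)" for n
    using assms represents_ev by blast
  then show ?thesis
    using sinner_tendsto[OF hilb_L2[OF represents_hilb[OF assms(1)]] hilb_L2[OF assms(2)] assms(3,4)] by simp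
qed

text \<open>A representing vector provides the extension of the evaluation functional: along any approximating
  sequence the values converge to the inner product with it.\<close>

lemma ev_ext_represents:
  assumes "represents q e" "\<psi> \<in> hilb Q \<Gamma>"
  shows "ev_ext Q \<Gamma> q \<psi> = sinner Q e \<psi>"
  unfolding ev_ext_def
proof (rule the_equality)
  show "\<forall>\<sigma>. range \<sigma> \<subseteq> \<Gamma> \<and> L2_conv Q \<sigma> \<psi> \<longrightarrow> (\<lambda>n. ev Q q (\<sigma> n)) \<longlonglongrightarrow> sinner Q e \<psi>"
    using ev_tendsto[OF assms] by auto
  fix z assume z: "\<forall>\<sigma>. range \<sigma> \<subseteq> \<Gamma> \<and> L2_conv Q \<sigma> \<psi> \<longrightarrow> (\<lambda>n. ev Q q (\<sigma> n)) \<longlonglongrightarrow> z"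
  obtain \<sigma> where "range \<sigma> \<subseteq> \<Gamma>" "L2_conv Q \<sigma> \<psi>" using assms(2) by (auto simp: hilb_def)
  then show "z = sinner Q e \<psi>" using z ev_tendsto[OF assms] LIMSEQ_unique by blast
qed

lemma coherent_vec_represents:
  assumes "q \<in> lbundle0 Q"
  shows "represents q (coherent_vec Q \<Gamma> q)"
proof -
  obtain e where e: "represents q e" using representing_vector_exists[OF assms] ..
  then have "\<exists>e. e \<in> hilb Q \<Gamma> \<and> (\<forall>\<psi>\<in>hilb Q \<Gamma>. ev_ext Q \<Gamma> q \<psi> = sinner Q e \<psi>)"
    using represents_hilb ev_ext_represents by blast
  from someI_ex[OF this] have *: "coherent_vec Q \<Gamma> q \<in> hilb Q \<Gamma>"
    "\<And>\<psi>. \<psi> \<in> hilb Q \<Gamma> \<Longrightarrow> ev_ext Q \<Gamma> q \<psi> = sinner Q (coherent_vec Q \<Gamma> q) \<psi>"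
    unfolding coherent_vec_def by auto
  have "sinner Q (coherent_vec Q \<Gamma> q) s = ev Q q s" if "s \<in> \<Gamma>" for s
    using *(2)[OF module_hilb[OF that]] ev_ext_represents[OF e module_hilb[OF that]]
      represents_ev[OF e that] by simp
  with *(1) show ?thesis by (simp add: represents_def)
qed

text \<open>Both vectors have the same inner product with every vector of the Hilbert space, in particular with each
  other, so \<open>norm_sq (e - e') = 0\<close>.\<close>

lemma represents_unique:
  assumes e: "represents q e" and e': "represents q e'"
  shows "sec_eq Q e e'"
proof -
  note L = hilb_L2[OF represents_hilb[OF e]] hilb_L2[OF represents_hilb[OF e']]
  note S = L2_sectionsD(1)[OF L(1)] L2_sectionsD(1)[OF L(2)]
  note T = L2_sectionsD(2)[OF L(1)] L2_sectionsD(2)[OF L(2)]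
  have "iprod (triv e) (triv \<psi>) = iprod (triv e') (triv \<psi>)" if "\<psi> \<in> hilb Q \<Gamma>" for \<psi>
    using ev_ext_represents[OF e that] ev_ext_represents[OF e' that]
    by (simp add: sinner_triv S hilb_section that)
  then have eqs: "iprod (triv e) (triv e) = iprod (triv e') (triv e)" "iprod (triv e) (triv e') = iprod (triv e') (triv e')"
    using e e' represents_hilb by blast+
  have "Re (iprod (triv e') (triv e)) = Re (iprod (triv e) (triv e'))"
    by (subst iprod_cnj) simp
  then have "norm_sq (triv e) = Re (iprod (triv e) (triv e'))" "norm_sq (triv e') = Re (iprod (triv e) (triv e'))"
    using arg_cong[OF eqs(1), of Re] arg_cong[OF eqs(2), of Re] by (simp_all add: iprod_self)
  then have "norm_sq (\<lambda>x. 1 * triv e x + (-1) * triv e' x) = 0"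
    unfolding norm_sq_linear[OF T] by simp
  moreover have "integrable (vol Q) (\<lambda>x. (cmod (triv e x - triv e' x))\<^sup>2)"
    by (intro L2_integrable L2_diff T)
  ultimately have "AE x in vol Q. (cmod (triv e x - triv e' x))\<^sup>2 = 0"
    unfolding norm_sq_def by (subst (asm) integral_nonneg_eq_0_iff_AE) auto
  then show ?thesis
    unfolding sec_eq_iff[OF S] by (rule AE_mp) auto
qed

text \<open>The heart of the matter. By unitarity \<open>\<langle>g e, s\<rangle> = \<langle>e, g\<^sup>-\<^sup>1 s\<rangle>\<close>, which is the value of \<open>g\<^sup>-\<^sup>1 s\<close> at \<open>x\<close> measured in
  units of \<open>q\<close>, and this is the value of \<open>s\<close> at \<open>g x\<close> measured in units of \<open>g q\<close>.\<close>

lemma represents_sact: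
  assumes e: "represents (lcls Q a v) e" and a: "a \<in> carrier Q" and v: "v \<noteq> 0" and g: "g \<in> carrier Q"
  shows "represents (lcls Q (g \<otimes> a) v) (sact Q g e)"
  unfolding represents_def
proof (intro conjI ballI)
  show "sact Q g e \<in> hilb Q \<Gamma>" by (intro hilb_sact represents_hilb[OF e] g)
  fix s assume s: "s \<in> \<Gamma>"
  note S = module_section[OF s]
  have s': "sact Q (inv g) s \<in> \<Gamma>" by (intro module_sact s inv_closed g)
  have "sinner Q (sact Q g e) s = sinner Q (sact Q g e) (sact Q g (sact Q (inv g) s))"
    by (simp add: sact_inv_sact[OF S g])
  also have "\<dots> = sinner Q e (sact Q (inv g) s)"
    by (intro sinner_sact module_L2 s' hilb_L2 represents_hilb[OF e] g)
  also have "\<dots> = ev Q (lcls Q a v) (sact Q (inv g) s)"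
    by (rule represents_ev[OF e s'])
  also have "\<dots> = ev Q (lcls Q (g \<otimes> a) v) s"
    using S a g v by (simp add: ev_lcls lift_sact)
  finally show "sinner Q (sact Q g e) s = ev Q (lcls Q (g \<otimes> a) v) s" .
qed

text \<open>Rescaling \<open>q\<close> by \<open>z\<close> divides the evaluation by \<open>z\<close>; the inner product is antilinear in its first argument,
  whence the conjugate.\<close>

lemma represents_sscale:
  assumes e: "represents (lcls Q a v) e" and a: "a \<in> carrier Q" and v: "v \<noteq> 0" and z: "z \<noteq> 0"
  shows "represents (lcls Q a (z * v)) (sscale Q (cnj (1 / z)) e)"
  unfolding represents_def
proof (intro conjI ballI)
  show "sscale Q (cnj (1 / z)) e \<in> hilb Q \<Gamma>" by (intro hilb_sscale represents_hilb[OF e])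
  fix s assume s: "s \<in> \<Gamma>"
  then show "sinner Q (sscale Q (cnj (1 / z)) e) s = ev Q (lcls Q a (z * v)) s"
    using represents_ev[OF e s] module_section[OF s] a v z
    by (simp add: sinner_sscale_left hilb_L2 represents_hilb[OF e] module_L2 ev_lcls)
qed

lemma coherent_vec_hilb: "q \<in> lbundle0 Q \<Longrightarrow> coherent_vec Q \<Gamma> q \<in> hilb Q \<Gamma>"
  using coherent_vec_represents represents_hilb by blast

lemma coherent_vec_section: "q \<in> lbundle0 Q \<Longrightarrow> coherent_vec Q \<Gamma> q \<in> lsections Q"
  using coherent_vec_hilb hilb_section by blast

text \<open>\<open>q'\<close> and \<open>g q\<close> lie in the same fibre, so \<open>q'\<close> is a nonzero multiple of \<open>g q\<close>. A multiple of \<open>g e\<^sub>q\<close> then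
  represents evaluation at \<open>q'\<close>, and uniqueness compares it with the coherent vector of \<open>q'\<close>.\<close>

lemma coherent_vec_equivariant:
  assumes g: "g \<in> carrier Q" and q: "q \<in> lbundle0 Q" and q': "q' \<in> lbundle0 Q"
    and proj: "lproj Q q' = coad Q g (lproj Q q)"
  shows "\<exists>c. c \<noteq> 0 \<and> sec_eq Q (sact Q g (coherent_vec Q \<Gamma> q)) (sscale Q c (coherent_vec Q \<Gamma> q'))"
proof -
  obtain a v where a: "a \<in> carrier Q" "v \<noteq> 0" "q = lcls Q a v" using q by (rule lbundle0E)
  obtain b w where b: "b \<in> carrier Q" "w \<noteq> 0" "q' = lcls Q b w" using q' by (rule lbundle0E)
  let ?t = "transition (g \<otimes> a) b * w"
  have ga: "g \<otimes> a \<in> carrier Q" using a g by simp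
  have pt: "pt (g \<otimes> a) = pt b"
    using proj a b g by (simp add: lproj_lcls coad_mult)
  then have q'_eq: "q' = lcls Q (g \<otimes> a) ?t"
    using lcls_change_representative[OF ga b(1)] b by simp
  have t: "?t \<noteq> 0" using transition_norm[OF ga b(1) pt] b(2) by auto
  define k where "k = cnj (1 / (?t / v))"
  have k: "k \<noteq> 0" using t a(2) by (simp add: k_def)
  have "represents (lcls Q (g \<otimes> a) v) (sact Q g (coherent_vec Q \<Gamma> q))"
    using represents_sact[OF _ a(1,2) g] coherent_vec_represents[OF q] a(3) by simp
  then have "represents q' (sscale Q k (sact Q g (coherent_vec Q \<Gamma> q)))"
    using represents_sscale[OF _ ga a(2), of _ "?t / v"] t a(2) unfolding k_def q'_eq by simp
  then have "sec_eq Q (coherent_vec Q \<Gamma> q') (sscale Q k (sact Q g (coherent_vec Q \<Gamma> q)))"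
    by (rule represents_unique[OF coherent_vec_represents[OF q']])
  from sec_eq_sscale_sym[OF _ _ k this] k show ?thesis
    using g q q' coherent_vec_section by (intro exI[of _ "1 / k"]) simp
qed

text \<open>If the coherent vector had norm zero, all sections in the module would vanish at the base point of \<open>q\<close>.
  The module is invariant and the orbit homogeneous, so they would vanish everywhere.\<close>

lemma coherent_vec_nonzero:
  assumes q: "q \<in> lbundle0 Q"
  shows "snorm Q (coherent_vec Q \<Gamma> q) \<noteq> 0"
proof
  let ?e = "coherent_vec Q \<Gamma> q"
  assume zero: "snorm Q ?e = 0"
  obtain a v where a: "a \<in> carrier Q" "v \<noteq> 0" "q = lcls Q a v" using q by (rule lbundle0E)
  have lift_zero: "lift Q s a = 0" if s: "s \<in> \<Gamma>" for s
  proof -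
    have "norm_sq (triv ?e) = 0"
      using zero coherent_vec_section[OF q] by (simp add: snorm_triv)
    moreover have "triv ?e \<in> L2" "triv s \<in> L2"
      using L2_sectionsD hilb_L2 module_L2 s coherent_vec_hilb[OF q] by auto
    ultimately have "iprod (triv ?e) (triv s) = 0"
      using Cauchy_Schwarz[of "triv ?e" "triv s"] by simp
    then have "ev Q q s = 0"
      using represents_ev[OF coherent_vec_represents[OF q] s] coherent_vec_section[OF q]
      by (simp add: sinner_triv module_section s)
    then show ?thesis using a by (simp add: ev_lcls module_section s)
  qed
  obtain s where s: "s \<in> \<Gamma>" "snorm Q s \<noteq> 0" using nontrivial by auto
  have "triv s x = 0" if x: "x \<in> orbit Q" for x
  proof -
    let ?g = "a \<otimes> inv (rep x)"
    have "lift Q (sact Q ?g s) a = 0"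
      using a rep[OF x] by (intro lift_zero module_sact s) auto
    then show ?thesis
      using a rep[OF x] by (simp add: lift_sact module_section s inv_mult_group m_assoc triv_def)
  qed
  then have "norm_sq (triv s) = norm_sq (\<lambda>x. 0)" by (rule norm_sq_cong)
  then show False
    using s by (simp add: snorm_triv module_section norm_sq_def)
qed

section \<open>Coherent states\<close>

lemma ray_eqI:
  assumes "\<phi> \<in> lsections Q" "\<psi> \<in> lsections Q" "c \<noteq> 0" "sec_eq Q \<phi> (sscale Q c \<psi>)"
  shows "ray Q \<Gamma> \<phi> = ray Q \<Gamma> \<psi>"
proof -
  have "ray Q \<Gamma> \<phi> \<subseteq> ray Q \<Gamma> \<psi>"
    if "\<phi> \<in> lsections Q" "\<psi> \<in> lsections Q" "c \<noteq> 0" "sec_eq Q \<phi> (sscale Q c \<psi>)" for \<phi> \<psi> c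
  proof
    fix \<rho> assume "\<rho> \<in> ray Q \<Gamma> \<phi>"
    then obtain d where d: "\<rho> \<in> hilb Q \<Gamma>" "d \<noteq> 0" "sec_eq Q \<rho> (sscale Q d \<phi>)"
      by (auto simp: ray_def)
    have "sec_eq Q \<rho> (sscale Q (d * c) \<psi>)"
      by (rule sec_eq_sscale_trans[OF hilb_section[OF d(1)] that(1,2) d(3) that(4)])
    then show "\<rho> \<in> ray Q \<Gamma> \<psi>"
      using d that(3) by (auto simp: ray_def intro!: exI[of _ "d * c"])
  qed
  from this[OF assms] this[OF assms(2,1) _ sec_eq_sscale_sym[OF assms]] assms(3) show ?thesis by auto
qed

lemma rawnsley_state_eq:
  assumes q: "q \<in> lbundle0 Q"
  shows "rawnsley_state Q \<Gamma> (lproj Q q) = ray Q \<Gamma> (coherent_vec Q \<Gamma> q)"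
  unfolding rawnsley_state_def
proof (rule the_equality)
  show "\<exists>q'\<in>lbundle0 Q. lproj Q q' = lproj Q q \<and> ray Q \<Gamma> (coherent_vec Q \<Gamma> q) = ray Q \<Gamma> (coherent_vec Q \<Gamma> q')"
    using q by blast
  fix r assume "\<exists>q'\<in>lbundle0 Q. lproj Q q' = lproj Q q \<and> r = ray Q \<Gamma> (coherent_vec Q \<Gamma> q')"
  then obtain q' where q': "q' \<in> lbundle0 Q" "lproj Q q' = lproj Q q" "r = ray Q \<Gamma> (coherent_vec Q \<Gamma> q')"
    by auto
  then obtain c where "c \<noteq> 0" "sec_eq Q (coherent_vec Q \<Gamma> q') (sscale Q c (coherent_vec Q \<Gamma> q))"
    using coherent_vec_equivariant[of \<one> q' q] q by (auto simp: coad_one sact_one coherent_vec_section)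
  then show "r = ray Q \<Gamma> (coherent_vec Q \<Gamma> q)"
    using q'(3) ray_eqI coherent_vec_section q q'(1) by blast
qed

lemma fibre_nonempty:
  assumes "x \<in> orbit Q"
  obtains q where "q \<in> lbundle0 Q" "lproj Q q = x"
proof
  show "lcls Q (rep x) 1 \<in> lbundle0 Q" "lproj Q (lcls Q (rep x) 1) = x"
    using rep[OF assms] unfolding lbundle0_def by (auto simp: lproj_lcls intro!: exI[of _ "rep x"] exI[of _ 1])
qed

lemma rawnsley_state_in_proj_hilb:
  assumes "x \<in> orbit Q"
  shows "rawnsley_state Q \<Gamma> x \<in> proj_hilb Q \<Gamma>"
proof -
  obtain q where q: "q \<in> lbundle0 Q" "lproj Q q = x" using fibre_nonempty[OF assms] .
  then have "rawnsley_state Q \<Gamma> x = ray Q \<Gamma> (coherent_vec Q \<Gamma> q)"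
    using rawnsley_state_eq by blast
  then show ?thesis
    using coherent_vec_hilb[OF q(1)] coherent_vec_nonzero[OF q(1)] unfolding proj_hilb_def by blast
qed

text \<open>The vacuum is determined by its ray only up to a factor and a null set; the action preserves both.\<close>

lemma translate_of_rawnsley_state:
  assumes x: "x \<in> orbit Q" and \<psi>: "\<psi> \<in> rawnsley_state Q \<Gamma> x" and g: "g \<in> carrier Q"
  shows "ray Q \<Gamma> (sact Q g \<psi>) = rawnsley_state Q \<Gamma> (coad Q g x)"
proof -
  obtain q where q: "q \<in> lbundle0 Q" "lproj Q q = x" using fibre_nonempty[OF x] .
  obtain q' where q': "q' \<in> lbundle0 Q" "lproj Q q' = coad Q g x"
    using fibre_nonempty[OF coad_in_orbit[OF g x]] .
  let ?e = "coherent_vec Q \<Gamma> q" and ?e' = "coherent_vec Q \<Gamma> q'"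
  note S = coherent_vec_section[OF q(1)] coherent_vec_section[OF q'(1)]
  obtain c where \<psi>_hilb: "\<psi> \<in> hilb Q \<Gamma>" and c: "c \<noteq> 0" "sec_eq Q \<psi> (sscale Q c ?e)"
    using \<psi> rawnsley_state_eq[OF q(1)] q(2) by (auto simp: ray_def)
  note \<psi>_section = hilb_section[OF \<psi>_hilb]
  have "sec_eq Q (sact Q g \<psi>) (sscale Q c (sact Q g ?e))"
    using sec_eq_sact[OF c(2) g] by (simp add: sact_sscale S g)
  then have "ray Q \<Gamma> (sact Q g \<psi>) = ray Q \<Gamma> (sact Q g ?e)"
    using ray_eqI[OF _ _ c(1)] \<psi>_section S g by simp
  also obtain d where "d \<noteq> 0" "sec_eq Q (sact Q g ?e) (sscale Q d ?e')"
    using coherent_vec_equivariant[OF g q(1) q'(1)] q q' by auto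
  then have "ray Q \<Gamma> (sact Q g ?e) = ray Q \<Gamma> ?e'"
    using ray_eqI S g by simp
  also have "\<dots> = rawnsley_state Q \<Gamma> (coad Q g x)"
    using rawnsley_state_eq[OF q'(1)] q'(2) by simp
  finally show ?thesis .
qed

lemma rawnsley_states_are_group_coherent_states:
  assumes x: "x \<in> orbit Q" and \<psi>: "\<psi> \<in> rawnsley_state Q \<Gamma> x"
  shows "{rawnsley_state Q \<Gamma> y |y. y \<in> orbit Q} = group_coherent_states Q \<Gamma> \<psi>"
proof -
  have "orbit Q = {coad Q g x |g. g \<in> carrier Q}"
  proof -
    obtain a where a: "a \<in> carrier Q" "x = pt a" using x by (auto elim: orbitE)
    have "\<exists>g. y = coad Q g x \<and> g \<in> carrier Q" if y: "y \<in> orbit Q" for y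
    proof -
      obtain b where b: "b \<in> carrier Q" "y = pt b" using y by (auto elim: orbitE)
      then have "y = coad Q (b \<otimes> inv a) x" using a by (simp add: coad_mult coad_inv_coad)
      then show ?thesis using a b by blast
    qed
    then show ?thesis using x by auto
  qed
  then show ?thesis
    unfolding group_coherent_states_def using translate_of_rawnsley_state[OF x \<psi>] by force
qed

end

theorem proposition7p5:
  fixes Q :: "('g, 'e::euclidean_space) quantum_data"
    and \<Gamma> :: "('g, 'e) sec set"
  assumes "kostant_souriau_data Q"
    and "prehilbert_module Q \<Gamma>"
    and "\<And>q. q \<in> lbundle0 Q \<Longrightarrow> ev_bounded Q \<Gamma> q"
    and "\<exists>s\<in>\<Gamma>. snorm Q s \<noteq> 0"
  shows "(\<forall>x\<in>orbit Q. rawnsley_state Q \<Gamma> x \<in> proj_hilb Q \<Gamma>) \<and>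
    (\<forall>g\<in>carrier Q. \<forall>q\<in>lbundle0 Q. \<forall>q'\<in>lbundle0 Q. lproj Q q' = coad Q g (lproj Q q) \<longrightarrow>
       (\<exists>c. c \<noteq> 0 \<and>
          sec_eq Q (sact Q g (coherent_vec Q \<Gamma> q)) (sscale Q c (coherent_vec Q \<Gamma> q')))) \<and>
    (\<forall>x\<^sub>0\<in>orbit Q. \<forall>\<psi>\<^sub>0\<in>rawnsley_state Q \<Gamma> x\<^sub>0.
       {rawnsley_state Q \<Gamma> x |x. x \<in> orbit Q} = group_coherent_states Q \<Gamma> \<psi>\<^sub>0)"
proof -
  interpret quantization_module Q \<Gamma>
    using assms by unfold_locales
  show ?thesis
    using rawnsley_state_in_proj_hilb coherent_vec_equivariant
      rawnsley_states_are_group_coherent_states by blast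
qed

end
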